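(* Let $r\ge1$ and let $R_r$ be the Young diagram consisting of a single row of $r$ boxes. There exist mutually inverse crystal isomorphisms $$\Phi:B(R_r)\otimes\mathbf B\to\mathbf B\otimes B(R_r),\qquad \Phi^{-1}:\mathbf B\otimes B(R_r)\to B(R_r)\otimes\mathbf B,$$ where, writing $[a_1,\dots,a_r]$ for the row tableau with entries $a_1,\dots,a_r$ from left to right, the correspondences are as follows. (i) If the two-box row with $b$ to the left of $a_1$ is semistandard, then $\Phi\big([a_1,\dots,a_r]\otimes b\big)=a_r\otimes[b,a_1,\dots,a_{r-1}]$. If the two-box column with $a_1$ above $b$ is semistandard, then $\Phi\big([a_1,\dots,a_r]\otimes b\big)=a_\nu\otimes[a_1,\dots,a_{\nu-1},b,a_{\nu+1},\dots,a_r]$, where $\nu$ is the largest integer such that the two-box column with $a_\nu$ above $b$ is semistandard. (ii) If the two-box row with $a_r$ to the left of $b$ is semistandard, then $\Phi^{-1}\big(b\otimes[a_1,\dots,a_r]\big)=[a_2,\dots,a_r,b]\otimes a_1$. If the two-box column with $b$ above $a_r$ is semistandard, then $\Phi^{-1}\big(b\otimes[a_1,\dots,a_r]\big)=[a_1,\dots,a_{\nu-1},b,a_{\nu+1},\dots,a_r]\otimes a_\nu$, where $\nu$ is the smallest integer such that the two-box column with $b$ above $a_\nu$ is semistandard.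
   Context: Fix integers $m,n\ge1$. $I=\{\overline{m-1},\dots,\overline1,0,1,\dots,n-1\}$. $\mathbf B=\mathbf B_+\sqcup\mathbf B_-$, $\mathbf B_+=\{\overline m,\dots,\overline1\}$, $\mathbf B_-=\{1,\dots,n\}$, ordered by $\overline m<\overline{m-1}<\dots<\overline1<1<2<\dots<n$; $P=\bigoplus_{b\in\mathbf B}\mathbb Z\epsilon_b$. $\mathbf B$ is a crystal with $\mathrm{wt}(b)=\epsilon_b$ and $\tilde f_ib=b'$ (equivalently $\tilde e_ib'=b$) exactly for $(i,b,b')=(\overline k,\overline{k+1},\overline k)$ ($1\le k\le m-1$), $(0,\overline1,1)$, $(k,k,k+1)$ ($1\le k\le n-1$); all other values are $0$. For an element $b$ of a crystal put $\varepsilon_i(b)=\max\{r\ge0:\tilde e_i^rb\ne0\}$, $\varphi_i(b)=\max\{r\ge0:\tilde f_i^rb\ne0\}$. The tensor product of crystals has weights $\mathrm{wt}(b_1\otimes b_2)=\mathrm{wt}(b_1)+\mathrm{wt}(b_2)$ and operators (with $0\otimes b=b\otimes 0=0$): - $i=\overline k$: $\tilde e_i(b_1\otimes b_2)=\tilde e_ib_1\otimes b_2$ if $\varphi_i(b_1)\ge\varepsilon_i(b_2)$, else $b_1\otimes\tilde e_ib_2$; $\tilde f_i(b_1\otimes b_2)=\tilde f_ib_1\otimes b_2$ if $\varphi_i(b_1)>\varepsilon_i(b_2)$, else $b_1\otimes\tilde f_ib_2$. - $i\in\{1,\dots,n-1\}$: $\tilde e_i(b_1\otimes b_2)=b_1\otimes\tilde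 e_ib_2$ if $\varphi_i(b_2)\ge\varepsilon_i(b_1)$, else $\tilde e_ib_1\otimes b_2$; $\tilde f_i(b_1\otimes b_2)=b_1\otimes\tilde f_ib_2$ if $\varphi_i(b_2)>\varepsilon_i(b_1)$, else $\tilde f_ib_1\otimes b_2$. - $i=0$: with $\langle h_0,\sum_b\lambda_b\epsilon_b\rangle=\lambda_{\overline1}+\lambda_1$, the operators $\tilde e_0,\tilde f_0$ act on the first factor if $\langle h_0,\mathrm{wt}(b_1)\rangle>0$, and on the second factor if $\langle h_0,\mathrm{wt}(b_1)\rangle=0$. A semistandard tableau is a filling with elements of $\mathbf B$, weakly increasing along rows from left to right with only elements of $\mathbf B_+$ allowed to repeat in a row, and weakly increasing down columns with only elements of $\mathbf B_-$ allowed to repeat in a column. Thus a two-box row with $x$ left of $y$ is semistandard iff $x<y$ or $x=y\in\mathbf B_+$; a two-box column with $x$ above $y$ is semistandard iff $x<y$ or $x=y\in\mathbf B_-$; for any $a,b$ exactly one of "row ($b$ left of $a$)", "column ($a$ above $b$)" is semistandard. $B(Y)$ is the set of semistandard tableaux of shape $Y$; $B(R_r)$ is a crystal via the identification of a row tableau $[a_1,\dots,a_r]$ with $a_r\otimes a_{r-1}\otimes\dots\otimes a_1\in\mathbf B^{\otimes r}$ (the image together with $0$ is stable under the operators). A crystal isomorphism is a weight-preserving bijection commuting with all $\tilde e_i,\tilde f_i$ ($0\mapsto0$). *)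

theory Defs
  imports Main
begin

(* The letter (or index) "k bar" is the negative integer -k, so that the order on letters is the
   usual order of int.  The integer 0 is an index but not a letter. *)

definition letters_pos :: "int \<Rightarrow> int set" where
  "letters_pos m = {- m .. - 1}"

definition letters_neg :: "int \<Rightarrow> int set" where
  "letters_neg n = {1 .. n}"

definition letters :: "int \<Rightarrow> int \<Rightarrow> int set" where
  "letters m n = letters_pos m \<union> letters_neg n"

definition indices :: "int \<Rightarrow> int \<Rightarrow> int set" where
  "indices m n = {- (m - 1) .. n - 1}"

(* The weight lattice is represented by coefficient functions int => int.
   In the codomain of the operators, None stands for the element 0 adjoined to a crystal.
   The values of the operators outside the carrier are irrelevant. *)

record 'b crystal =
  elems :: "'b set"
  wt :: "'b \<Rightarrow> int \<Rightarrow> int"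
  eop :: "int \<Rightarrow> 'b \<Rightarrow> 'b option"
  fop :: "int \<Rightarrow> 'b \<Rightarrow> 'b option"

(* max {k >= 0. g^k b is not 0}; only meaningful where this set is finite. *)
definition string_length :: "('b \<Rightarrow> 'b option) \<Rightarrow> 'b \<Rightarrow> nat" where
  "string_length g b = Max {k. ((\<lambda>x. Option.bind x g) ^^ k) (Some b) \<noteq> None}"

definition eps :: "'b crystal \<Rightarrow> int \<Rightarrow> 'b \<Rightarrow> nat" where
  "eps C i b = string_length (eop C i) b"

definition phi :: "'b crystal \<Rightarrow> int \<Rightarrow> 'b \<Rightarrow> nat" where
  "phi C i b = string_length (fop C i) b"

(* The i-arrow goes from arrow_src i to arrow_tgt i:
   for i = -k it is -(k+1) -> -k, for i = 0 it is -1 -> 1, and for i = k it is k -> k+1. *)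

definition arrow_src :: "int \<Rightarrow> int" where
  "arrow_src i = (if i \<le> 0 then i - 1 else i)"

definition arrow_tgt :: "int \<Rightarrow> int" where
  "arrow_tgt i = (if i < 0 then i else i + 1)"

definition letter_crystal :: "int \<Rightarrow> int \<Rightarrow> int crystal" where
  "letter_crystal m n =
     \<lparr> elems = letters m n,
       wt = (\<lambda>b c. if c = b then 1 else 0),
       eop = (\<lambda>i b. if i \<in> indices m n \<and> b = arrow_tgt i then Some (arrow_src i) else None),
       fop = (\<lambda>i b. if i \<in> indices m n \<and> b = arrow_src i then Some (arrow_tgt i) else None) \<rparr>"

definition h0_pairing :: "(int \<Rightarrow> int) \<Rightarrow> int" where
  "h0_pairing v = v (- 1) + v 1"

definition on_fst :: "('a \<Rightarrow> 'a option) \<Rightarrow> 'a \<times> 'b \<Rightarrow> ('a \<times> 'b) option" where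
  "on_fst g p = map_option (\<lambda>x. (x, snd p)) (g (fst p))"

definition on_snd :: "('b \<Rightarrow> 'b option) \<Rightarrow> 'a \<times> 'b \<Rightarrow> ('a \<times> 'b) option" where
  "on_snd g p = map_option (\<lambda>y. (fst p, y)) (g (snd p))"

(* For i = 0 the rule only speaks of pairings with h_0 that are >= 0, which is always the case
   for crystals of words. *)
definition tensor :: "'a crystal \<Rightarrow> 'b crystal \<Rightarrow> ('a \<times> 'b) crystal" where
  "tensor C D =
     \<lparr> elems = elems C \<times> elems D,
       wt = (\<lambda>(x, y) c. wt C x c + wt D y c),
       eop = (\<lambda>i (x, y).
         if i < 0 then
           (if phi C i x \<ge> eps D i y then on_fst (eop C i) (x, y) else on_snd (eop D i) (x, y))
         else if i > 0 then
           (if phi D i y \<ge> eps C i x then on_snd (eop D i) (x, y) else on_fst (eop C i) (x, y))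
         else
           (if h0_pairing (wt C x) > 0 then on_fst (eop C i) (x, y)
            else on_snd (eop D i) (x, y))),
       fop = (\<lambda>i (x, y).
         if i < 0 then
           (if phi C i x > eps D i y then on_fst (fop C i) (x, y) else on_snd (fop D i) (x, y))
         else if i > 0 then
           (if phi D i y > eps C i x then on_snd (fop D i) (x, y) else on_fst (fop C i) (x, y))
         else
           (if h0_pairing (wt C x) > 0 then on_fst (fop C i) (x, y)
            else on_snd (fop D i) (x, y))) \<rparr>"

(* Transport of structure along an injection g with left inverse h. *)
definition transport :: "('a \<Rightarrow> 'b) \<Rightarrow> ('b \<Rightarrow> 'a) \<Rightarrow> 'a crystal \<Rightarrow> 'b crystal" where
  "transport g h C =
     \<lparr> elems = g ` elems C,
       wt = (\<lambda>y. wt C (h y)),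
       eop = (\<lambda>i y. map_option g (eop C i (h y))),
       fop = (\<lambda>i y. map_option g (fop C i (h y))) \<rparr>"

(* The pure tensor b_1 (x) (b_2 (x) (... (x) b_r)) is written as the list [b_1, ..., b_r].
   The value at exponent 0 is a dummy. *)
fun tensor_power :: "'b crystal \<Rightarrow> nat \<Rightarrow> 'b list crystal" where
  "tensor_power C 0 =
     \<lparr> elems = {[]}, wt = (\<lambda>_ _. 0), eop = (\<lambda>_ _. None), fop = (\<lambda>_ _. None) \<rparr>"
| "tensor_power C (Suc 0) = transport (\<lambda>b. [b]) hd C"
| "tensor_power C (Suc (Suc r)) =
     transport (\<lambda>(b, bs). b # bs) (\<lambda>w. (hd w, tl w)) (tensor C (tensor_power C (Suc r)))"

(* Row tableaux are listed from left to right, column tableaux from top to bottom. *)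

definition semistandard_row :: "int \<Rightarrow> int \<Rightarrow> int list \<Rightarrow> bool" where
  "semistandard_row m n as \<longleftrightarrow>
     set as \<subseteq> letters m n \<and>
     sorted_wrt (\<lambda>x y. x \<le> y \<and> (x = y \<longrightarrow> x \<in> letters_pos m)) as"

definition semistandard_col :: "int \<Rightarrow> int \<Rightarrow> int list \<Rightarrow> bool" where
  "semistandard_col m n as \<longleftrightarrow>
     set as \<subseteq> letters m n \<and>
     sorted_wrt (\<lambda>x y. x \<le> y \<and> (x = y \<longrightarrow> x \<in> letters_neg n)) as"

(* The row [a_1, ..., a_r] is read as the tensor a_r (x) ... (x) a_1, whence the reversal. *)
definition row_crystal :: "int \<Rightarrow> int \<Rightarrow> nat \<Rightarrow> int list crystal" where
  "row_crystal m n r =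
     (transport rev rev (tensor_power (letter_crystal m n) r))
       \<lparr> elems := {as. length as = r \<and> semistandard_row m n as} \<rparr>"

definition crystal_iso ::
    "int set \<Rightarrow> 'a crystal \<Rightarrow> 'b crystal \<Rightarrow> ('a \<Rightarrow> 'b) \<Rightarrow> bool" where
  "crystal_iso I C D F \<longleftrightarrow>
     bij_betw F (elems C) (elems D) \<and>
     (\<forall>x \<in> elems C. wt D (F x) = wt C x) \<and>
     (\<forall>i \<in> I. \<forall>x \<in> elems C. eop D i (F x) = map_option F (eop C i x)) \<and>
     (\<forall>i \<in> I. \<forall>x \<in> elems C. fop D i (F x) = map_option F (fop C i x))"

end

theory Submission
  imports Defs "HOL-Library.Multiset"
begin

text \<open>
The map \<open>\<Phi>\<close> has a uniform description. Arrange the letters cyclically. Then \<open>\<Phi>\<close> lets the incoming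
letter \<open>b\<close> replace its cyclic predecessor \<open>a\<close> among the entries of the row, and \<open>a\<close> comes out on the
other side: \<open>a\<close> is the largest entry that can stand above \<open>b\<close> in a column, or the largest entry at
all if there is none. (A letter that may not repeat in a row counts as its own predecessor, so that
\<open>b\<close> expels its own copy, whereas a letter that may repeat counts as its own predecessor only as a
last resort.) The two explicit descriptions of \<open>\<Phi>\<close> are the two cases of this definition
(\<open>exchange_row\<close>, \<open>exchange_col\<close>). The inverse map replaces a cyclic successor instead. The two
maps are mutually inverse because after the exchange nothing is left between \<open>a\<close> and \<open>b\<close>
(\<open>is_succ_replaced\<close>, \<open>is_pred_replaced\<close>), and weights are preserved because the total
content is.

For the operators, the first point is that a row is nothing but a multiset with restricted
multiplicities. The reading word of a row is decreasing, and by induction on its length the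
operators \<open>e\<^sub>i\<close>, \<open>f\<^sub>i\<close> replace one letter by its neighbour, under conditions that only involve the
multiplicities of these two letters \<open>s\<close>, \<open>t\<close> (\<open>tensor_power_row\<close>). This also makes the operators on
both tensor products explicit.

The second point is that the exchange map hardly notices the difference between the adjacent
letters \<open>s\<close> and \<open>t\<close>: the content on both sides changes in the same way, so that commutation reduces
to comparing the letter that comes out (\<open>exchange_commutes\<close>), and this letter can be affected only
if \<open>a\<close> or \<open>b\<close> is one of \<open>s\<close>, \<open>t\<close>. The remaining comparison is a finite case analysis, done once for
each operator and each of the three kinds of indices (locale \<open>adjacent_letters\<close>).
\<close>

section \<open>String lengths\<close>

text \<open>
A string length is the maximum of a set of exponents and is awkward to compute as such. It is enough to exhibit a counter \<open>\<mu>\<close> that drops by one along every step of the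
operator and vanishes exactly where the operator gives \<open>0\<close>; the set \<open>S\<close> is there because the
operators are understood only on elements of the crystal.
\<close>
lemma string_length_eqI:
  fixes g :: "'b \<Rightarrow> 'b option" and \<mu> :: "'b \<Rightarrow> nat"
  assumes closed: "\<And>x y. x \<in> S \<Longrightarrow> g x = Some y \<Longrightarrow> y \<in> S \<and> \<mu> x = Suc (\<mu> y)"
    and stop: "\<And>x. x \<in> S \<Longrightarrow> g x = None \<Longrightarrow> \<mu> x = 0"
    and "x \<in> S"
  shows "string_length g x = \<mu> x"
proof -
  have none: "((\<lambda>z. Option.bind z g) ^^ k) None = None" for k
    by (induction k) auto
  have iter: "((\<lambda>z. Option.bind z g) ^^ k) (Some x) \<noteq> None \<longleftrightarrow> k \<le> \<mu> x" if "x \<in> S" for x k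
    using that
  proof (induction k arbitrary: x)
    case 0
    then show ?case by simp
  next
    case (Suc k)
    show ?case
    proof (cases "g x")
      case None
      then show ?thesis using stop[OF Suc.prems] none by (simp add: funpow_Suc_right del: funpow.simps)
    next
      case (Some y)
      then show ?thesis using closed[OF Suc.prems Some] Suc.IH[of y]
        by (simp add: funpow_Suc_right del: funpow.simps)
    qed
  qed
  have "{k. ((\<lambda>z. Option.bind z g) ^^ k) (Some x) \<noteq> None} = {..\<mu> x}"
    using iter[OF \<open>x \<in> S\<close>] by auto
  then have "string_length g x = Max {..\<mu> x}"
    unfolding string_length_def by simp
  also have "\<dots> = \<mu> x"
    by (rule Max_eqI) auto
  finally show ?thesis .
qed

section \<open>Rows as sorted multisets\<close>

text \<open>
A row is determined by its multiset of entries: sorting recovers the order, and semistandardness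
only limits the multiplicities of the letters of \<open>B_-\<close>, which are the positive integers. All
later arguments are about contents.
\<close>
lemma semistandard_row_iff:
  "semistandard_row m n as \<longleftrightarrow>
     set as \<subseteq> letters m n \<and> sorted as \<and> (\<forall>x>0. count (mset as) x \<le> 1)"
proof (induction as)
  case Nil
  then show ?case by (simp add: semistandard_row_def)
next
  case (Cons a as)
  have "semistandard_row m n (a # as) \<longleftrightarrow> a \<in> letters m n \<and> semistandard_row m n as \<and>
      (\<forall>x\<in>set as. a \<le> x \<and> (a = x \<longrightarrow> a \<in> letters_pos m))"
    unfolding semistandard_row_def by auto
  also have "\<dots> \<longleftrightarrow> a \<in> letters m n \<and> semistandard_row m n as \<and>
      (\<forall>x\<in>set as. a \<le> x) \<and> (0 < a \<longrightarrow> a \<notin> set as)"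
    by (auto simp: letters_def letters_pos_def letters_neg_def)
  also have "\<dots> \<longleftrightarrow> set (a # as) \<subseteq> letters m n \<and> sorted (a # as) \<and> (\<forall>x>0. count (mset (a # as)) x \<le> 1)"
    unfolding Cons.IH by (auto simp: count_eq_zero_iff le_Suc_eq split: if_splits)
  finally show ?case .
qed

lemma sorted_eqI: "sorted xs \<Longrightarrow> sorted ys \<Longrightarrow> mset xs = mset ys \<Longrightarrow> xs = ys"
  for xs ys :: "int list"
  by (metis properties_for_sort sorted_sort_id)

definition replace :: "int \<Rightarrow> int \<Rightarrow> int list \<Rightarrow> int list" where
  "replace x y as = insort y (remove1 x as)"

lemma mset_replace [simp]: "mset (replace x y as) = add_mset y (mset as - {#x#})"
  by (simp add: replace_def)

lemma sorted_replace: "sorted as \<Longrightarrow> sorted (replace x y as)"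
  by (simp add: replace_def sorted_insort sorted_remove1)

lemma length_replace: "x \<in> set as \<Longrightarrow> length (replace x y as) = length as"
  by (metis mset_replace size_mset insert_DiffM set_mset_mset size_add_mset)

lemma set_replace: "set (replace x y as) = insert y (set_mset (mset as - {#x#}))"
  by (metis mset_replace set_mset_add_mset_insert set_mset_mset)

text \<open>
Of the multiplicities, only the distinction between single and repeated letters matters for which
letters occur afterwards.
\<close>
lemma mem_replace:
  assumes "x \<in> set as"
  shows "z \<in> set (replace x y as) \<longleftrightarrow> z = y \<or> z \<in> set as \<and> (z = x \<longrightarrow> 2 \<le> count (mset as) x)"
proof -
  have "z \<in># mset as - {#x#} \<longleftrightarrow> z \<in> set as \<and> (z = x \<longrightarrow> 2 \<le> count (mset as) x)"
    using assms by (auto simp: in_diff_count dest: in_diffD)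
  then show ?thesis unfolding set_replace by simp
qed

lemma replace_eqI:
  "sorted as \<Longrightarrow> sorted bs \<Longrightarrow> mset bs = add_mset y (mset as - {#x#}) \<Longrightarrow> bs = replace x y as"
  by (rule sorted_eqI) (auto simp: sorted_replace)

lemma semistandard_row_replace:
  assumes "semistandard_row m n as" "y \<in> letters m n" "0 < y \<Longrightarrow> y \<in> set as \<Longrightarrow> x = y"
  shows "semistandard_row m n (replace x y as)"
proof -
  have "set (replace x y as) \<subseteq> letters m n"
    using assms unfolding semistandard_row_iff set_replace by (fastforce dest: in_diffD)
  moreover have "sorted (replace x y as)" using assms sorted_replace semistandard_row_iff by blast
  moreover have "count (mset (replace x y as)) z \<le> 1" if "0 < z" for z
  proof -
    have le1: "count (mset as) z \<le> 1" using assms(1) that by (simp add: semistandard_row_iff)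
    have "count (mset as) y = 0" if "0 < y" "x \<noteq> y"
      using assms(3) that by (simp add: count_eq_zero_iff) blast
    with le1 \<open>0 < z\<close> show ?thesis by (cases "z = y"; cases "x = y") (auto simp: count_eq_zero_iff)
  qed
  ultimately show ?thesis unfolding semistandard_row_iff by blast
qed

section \<open>Crystal operators on rows\<close>

text \<open>
The reading word of a row is weakly decreasing, so the tensor product rule leaves little freedom.
For \<open>i < 0\<close> all letters \<open>t\<close> stand before all letters \<open>s\<close> and nothing cancels. For \<open>0 < i\<close> each of
\<open>s\<close>, \<open>t\<close> occurs at most once, and a pair \<open>t \<otimes> s\<close> is inert. For \<open>i = 0\<close> the operators see only the
first letter among \<open>s\<close>, \<open>t\<close>, which is \<open>t\<close> as soon as \<open>t\<close> occurs. In each case a row operator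
trades one letter for its neighbour, provided the result is again semistandard.
\<close>
definition row_e :: "int \<Rightarrow> int list \<Rightarrow> int list option" where
  "row_e i as = (if arrow_tgt i \<in> set as \<and> (0 < i \<longrightarrow> arrow_src i \<notin> set as)
     then Some (replace (arrow_tgt i) (arrow_src i) as) else None)"

definition row_f :: "int \<Rightarrow> int list \<Rightarrow> int list option" where
  "row_f i as = (if arrow_src i \<in> set as \<and> (0 \<le> i \<longrightarrow> arrow_tgt i \<notin> set as)
     then Some (replace (arrow_src i) (arrow_tgt i) as) else None)"

text \<open>
The values at \<open>i = 0\<close> are dummies: the tensor product rule for \<open>i = 0\<close> does not consult string
lengths.
\<close>
definition row_eps :: "int \<Rightarrow> int list \<Rightarrow> nat" where
  "row_eps i as = (if i < 0 then count (mset as) (arrow_tgt i)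
     else if arrow_tgt i \<in> set as \<and> arrow_src i \<notin> set as then 1 else 0)"

definition row_phi :: "int \<Rightarrow> int list \<Rightarrow> nat" where
  "row_phi i as = (if i < 0 then count (mset as) (arrow_src i)
     else if arrow_src i \<in> set as \<and> arrow_tgt i \<notin> set as then 1 else 0)"

lemma arrow_less: "arrow_src i < arrow_tgt i"
  by (auto simp: arrow_src_def arrow_tgt_def)

lemma arrow_letters:
  assumes "i \<in> indices m n" "m \<ge> 1" "n \<ge> 1"
  shows "arrow_src i \<in> letters m n" "arrow_tgt i \<in> letters m n"
  using assms by (auto simp: arrow_src_def arrow_tgt_def letters_def letters_pos_def letters_neg_def indices_def)

text \<open>
Source and target of an arrow are consecutive letters; for \<open>i = 0\<close> the only integer strictly between
them is \<open>0\<close>, which is not a letter.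
\<close>
lemma arrow_covers:
  assumes "x \<in> letters m n"
  shows "x \<le> arrow_src i \<or> arrow_tgt i \<le> x"
  using assms by (auto simp: arrow_src_def arrow_tgt_def letters_def letters_pos_def letters_neg_def)

lemma row_e_closed:
  assumes "row_e i as = Some bs" "semistandard_row m n as" "i \<in> indices m n" "m \<ge> 1" "n \<ge> 1"
  shows "semistandard_row m n bs \<and> length bs = length as"
  using assms arrow_letters[OF assms(3-5)]
  by (auto simp: row_e_def arrow_src_def length_replace split: if_splits intro: semistandard_row_replace)

lemma row_f_closed:
  assumes "row_f i as = Some bs" "semistandard_row m n as" "i \<in> indices m n" "m \<ge> 1" "n \<ge> 1"
  shows "semistandard_row m n bs \<and> length bs = length as"
  using assms arrow_letters[OF assms(3-5)]
  by (auto simp: row_f_def arrow_tgt_def length_replace split: if_splits intro: semistandard_row_replace)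

lemma count_replace:
  assumes "x \<in> set as" "x \<noteq> y"
  shows "count (mset as) x = Suc (count (mset (replace x y as)) x)"
proof -
  obtain M where "mset as = add_mset x M"
    using multi_member_split[of x "mset as"] assms(1) by auto
  then show ?thesis using assms(2) by simp
qed

lemma row_eps_step:
  assumes "row_e i as = Some bs" "i \<noteq> 0"
  shows "row_eps i as = Suc (row_eps i bs)"
proof -
  have *: "arrow_tgt i \<in> set as" "0 < i \<longrightarrow> arrow_src i \<notin> set as"
    and bs: "bs = replace (arrow_tgt i) (arrow_src i) as"
    using assms(1) by (simp_all add: row_e_def split: if_splits)
  have "arrow_src i \<in> set bs" by (simp add: bs set_replace)
  moreover have "count (mset as) (arrow_tgt i) = Suc (count (mset bs) (arrow_tgt i))"
    unfolding bs using *(1) arrow_less[of i] by (intro count_replace) auto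
  ultimately show ?thesis
    using * assms(2) unfolding row_eps_def by (cases "i < 0") simp_all
qed

lemma row_phi_step:
  assumes "row_f i as = Some bs" "i \<noteq> 0"
  shows "row_phi i as = Suc (row_phi i bs)"
proof -
  have *: "arrow_src i \<in> set as" "0 \<le> i \<longrightarrow> arrow_tgt i \<notin> set as"
    and bs: "bs = replace (arrow_src i) (arrow_tgt i) as"
    using assms(1) by (simp_all add: row_f_def split: if_splits)
  have "arrow_tgt i \<in> set bs" by (simp add: bs set_replace)
  moreover have "count (mset as) (arrow_src i) = Suc (count (mset bs) (arrow_src i))"
    unfolding bs using *(1) arrow_less[of i] by (intro count_replace) auto
  ultimately show ?thesis
    using * assms(2) unfolding row_phi_def by (cases "i < 0") simp_all
qed

text \<open>
The injection \<open>\<rho>\<close> allows the same computation for rows and for their reading words, which are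
the reversed rows.
\<close>
lemma eps_of_row_e:
  assumes "m \<ge> 1" "n \<ge> 1" and i: "i \<in> indices m n" "i \<noteq> 0" and "inj \<rho>"
    and eop: "\<And>bs. semistandard_row m n bs \<Longrightarrow> length bs = r \<Longrightarrow>
                eop C i (\<rho> bs) = map_option \<rho> (row_e i bs)"
    and as: "semistandard_row m n as" "length as = r"
  shows "eps C i (\<rho> as) = row_eps i as"
proof -
  let ?S = "\<rho> ` {bs. semistandard_row m n bs \<and> length bs = r}"
  have "string_length (eop C i) (\<rho> as) = (row_eps i \<circ> inv \<rho>) (\<rho> as)"
  proof (rule string_length_eqI[where S = ?S])
    fix x y assume "x \<in> ?S" "eop C i x = Some y"
    then obtain bs cs where *: "x = \<rho> bs" "y = \<rho> cs" "row_e i bs = Some cs"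
      "semistandard_row m n bs" "length bs = r"
      using eop by auto
    have "row_eps i bs = Suc (row_eps i cs)"
      by (rule row_eps_step[OF *(3) i(2)])
    then show "y \<in> ?S \<and> (row_eps i \<circ> inv \<rho>) x = Suc ((row_eps i \<circ> inv \<rho>) y)"
      using * row_e_closed[OF *(3,4) i(1) assms(1,2)] \<open>inj \<rho>\<close> by auto
  next
    fix x assume "x \<in> ?S" "eop C i x = None"
    then obtain bs where *: "x = \<rho> bs" "row_e i bs = None" using eop by auto
    then show "(row_eps i \<circ> inv \<rho>) x = 0"
      using i(2) \<open>inj \<rho>\<close> by (auto simp: row_e_def row_eps_def count_eq_zero_iff split: if_splits)
  qed (use as in auto)
  then show ?thesis using \<open>inj \<rho>\<close> by (simp add: eps_def)
qed

lemma phi_of_row_f: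
  assumes "m \<ge> 1" "n \<ge> 1" and i: "i \<in> indices m n" "i \<noteq> 0" and "inj \<rho>"
    and fop: "\<And>bs. semistandard_row m n bs \<Longrightarrow> length bs = r \<Longrightarrow>
                fop C i (\<rho> bs) = map_option \<rho> (row_f i bs)"
    and as: "semistandard_row m n as" "length as = r"
  shows "phi C i (\<rho> as) = row_phi i as"
proof -
  let ?S = "\<rho> ` {bs. semistandard_row m n bs \<and> length bs = r}"
  have "string_length (fop C i) (\<rho> as) = (row_phi i \<circ> inv \<rho>) (\<rho> as)"
  proof (rule string_length_eqI[where S = ?S])
    fix x y assume "x \<in> ?S" "fop C i x = Some y"
    then obtain bs cs where *: "x = \<rho> bs" "y = \<rho> cs" "row_f i bs = Some cs"
      "semistandard_row m n bs" "length bs = r"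
      using fop by auto
    have "row_phi i bs = Suc (row_phi i cs)"
      by (rule row_phi_step[OF *(3) i(2)])
    then show "y \<in> ?S \<and> (row_phi i \<circ> inv \<rho>) x = Suc ((row_phi i \<circ> inv \<rho>) y)"
      using * row_f_closed[OF *(3,4) i(1) assms(1,2)] \<open>inj \<rho>\<close> by auto
  next
    fix x assume "x \<in> ?S" "fop C i x = None"
    then obtain bs where *: "x = \<rho> bs" "row_f i bs = None" using fop by auto
    then show "(row_phi i \<circ> inv \<rho>) x = 0"
      using i(2) \<open>inj \<rho>\<close> by (auto simp: row_f_def row_phi_def count_eq_zero_iff split: if_splits)
  qed (use as in auto)
  then show ?thesis using \<open>inj \<rho>\<close> by (simp add: phi_def)
qed

lemma letter_eps_phi:
  assumes "i \<in> indices m n"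
  shows "eps (letter_crystal m n) i b = (if b = arrow_tgt i then 1 else 0)"
    and "phi (letter_crystal m n) i b = (if b = arrow_src i then 1 else 0)"
proof -
  have "string_length (eop (letter_crystal m n) i) b = (\<lambda>b. if b = arrow_tgt i then 1 else 0) b"
    by (rule string_length_eqI[where S = UNIV])
      (use assms arrow_less[of i] in \<open>simp_all add: letter_crystal_def split: if_splits\<close>)
  then show "eps (letter_crystal m n) i b = (if b = arrow_tgt i then 1 else 0)"
    by (simp add: eps_def)
  have "string_length (fop (letter_crystal m n) i) b = (\<lambda>b. if b = arrow_src i then 1 else 0) b"
    by (rule string_length_eqI[where S = UNIV])
      (use assms arrow_less[of i] in \<open>simp_all add: letter_crystal_def split: if_splits\<close>)
  then show "phi (letter_crystal m n) i b = (if b = arrow_src i then 1 else 0)"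
    by (simp add: phi_def)
qed

lemma sorted_snoc: "sorted (as @ [b]) \<longleftrightarrow> sorted as \<and> (\<forall>x\<in>set as. x \<le> b)" for b :: int
  by (auto simp: sorted_append)

lemma semistandard_row_snoc:
  "semistandard_row m n (as @ [b]) \<longleftrightarrow> semistandard_row m n as \<and> b \<in> letters m n \<and>
     (\<forall>x\<in>set as. x \<le> b) \<and> (0 < b \<longrightarrow> b \<notin> set as)"
  by (auto simp: semistandard_row_iff sorted_snoc count_eq_zero_iff le_Suc_eq split: if_splits)

text \<open>
Induction on the length, splitting off the largest entry \<open>b\<close>, which is the first letter of the
reading word. The remaining row obeys the formulas by induction, hence its string lengths are
known, and the tensor product rule decides between \<open>b\<close> and the rest. It moves \<open>b\<close> only when
replacing \<open>b\<close> keeps the word decreasing, so the outcome is the reading word of a row in both cases.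
\<close>
lemma tensor_power_row:
  assumes "m \<ge> 1" "n \<ge> 1" "i \<in> indices m n" "semistandard_row m n as" "length as = Suc r"
  shows "eop (tensor_power (letter_crystal m n) (Suc r)) i (rev as) = map_option rev (row_e i as) \<and>
         fop (tensor_power (letter_crystal m n) (Suc r)) i (rev as) = map_option rev (row_f i as)"
  using assms(4,5)
proof (induction r arbitrary: as)
  case 0
  then obtain a where "as = [a]" by (auto simp: length_Suc_conv)
  then show ?case using \<open>i \<in> indices m n\<close> arrow_less[of i]
    by (auto simp: transport_def letter_crystal_def row_e_def row_f_def replace_def)
next
  case (Suc r)
  let ?L = "letter_crystal m n" and ?T = "tensor_power (letter_crystal m n) (Suc r)"
  let ?s = "arrow_src i" and ?t = "arrow_tgt i"
  from Suc.prems obtain cs b where as: "as = cs @ [b]" and len: "length cs = Suc r"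
    by (metis append_butlast_last_id length_append_singleton length_0_conv nat.distinct(1) nat.inject)
  from Suc.prems(1) have row: "semistandard_row m n cs" and b: "b \<in> letters m n"
    and le: "\<forall>x\<in>set cs. x \<le> b" and new: "0 < b \<longrightarrow> b \<notin> set cs"
    unfolding as semistandard_row_snoc by auto
  have srt: "sorted cs" and lets: "set cs \<subseteq> letters m n" and srt_as: "sorted as"
    using row Suc.prems(1) by (auto simp: semistandard_row_iff)
  note ops = Suc.IH[OF row len]
  have eps: "eps ?T i (rev cs) = row_eps i cs" if "i \<noteq> 0"
    by (rule eps_of_row_e[where r = "Suc r"]) (use assms that Suc.IH row len in \<open>auto simp del: tensor_power.simps\<close>)
  have phi: "phi ?T i (rev cs) = row_phi i cs" if "i \<noteq> 0"
    by (rule phi_of_row_f[where r = "Suc r"]) (use assms that Suc.IH row len in \<open>auto simp del: tensor_power.simps\<close>)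
  have first_e: "rev (replace ?t ?s as) = ?s # rev cs" if "b = ?t" "?t \<notin> set cs"
  proof -
    have "\<forall>x\<in>set cs. x \<le> ?s"
      using that le lets arrow_covers[of _ m n i] by fastforce
    then have "cs @ [?s] = replace ?t ?s as"
      by (intro replace_eqI) (use that srt srt_as in \<open>auto simp: as sorted_snoc\<close>)
    from this[symmetric] show ?thesis by simp
  qed
  have first_f: "rev (replace ?s ?t as) = ?t # rev cs" if "b = ?s"
  proof -
    have "\<forall>x\<in>set cs. x \<le> ?t"
      using that le arrow_less[of i] by fastforce
    then have "cs @ [?t] = replace ?s ?t as"
      by (intro replace_eqI) (use that srt srt_as in \<open>auto simp: as sorted_snoc\<close>)
    from this[symmetric] show ?thesis by simp
  qed
  have rest: "rev (replace x y as) = b # rev (replace x y cs)" if "x \<in> set cs" "y \<le> b" for x y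
  proof -
    have "replace x y cs @ [b] = replace x y as"
      by (intro replace_eqI)
        (use that srt srt_as le in \<open>auto simp: as sorted_snoc sorted_replace mem_replace\<close>)
    from this[symmetric] show ?thesis by simp
  qed
  have s_le: "?s \<le> b" if "?t \<in> set cs" using that le arrow_less[of i] by force
  have t_le: "?t \<le> b" if "?s \<in> set cs" "b \<noteq> ?s"
    using that le b arrow_covers[of b m n i] by force
  have eopT: "eop (tensor_power ?L (Suc (Suc r))) i (rev as) =
     map_option (\<lambda>(b, bs). b # bs) (eop (tensor ?L ?T) i (b, rev cs))"
    and fopT: "fop (tensor_power ?L (Suc (Suc r))) i (rev as) =
     map_option (\<lambda>(b, bs). b # bs) (fop (tensor ?L ?T) i (b, rev cs))"
    by (simp_all add: as transport_def)
  have set_as: "x \<in> set as \<longleftrightarrow> x = b \<or> x \<in> set cs" for x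
    by (auto simp: as)
  have wtL: "h0_pairing (wt ?L b) > 0 \<longleftrightarrow> b = -1 \<or> b = 1"
    by (auto simp: h0_pairing_def letter_crystal_def)
  have letL: "eop ?L i b = (if b = ?t then Some ?s else None)" "fop ?L i b = (if b = ?s then Some ?t else None)"
    using assms(3) by (auto simp: letter_crystal_def)
  have le': "x \<le> b" if "x \<in> set cs" for x using le that by blast
  have st: "?s < ?t" by (rule arrow_less)
  have no_t: "?t \<notin> set cs" if "b = ?s"
    using that le' st by force
  have new': "b \<notin> set cs" if "b = ?t" "0 \<le> i"
    using new that by (auto simp: arrow_tgt_def)
  have count_t: "count (mset cs) ?t = 0 \<longleftrightarrow> ?t \<notin> set cs"
    by simp
  have sign0: "b = -1 \<or> b = 1 \<longleftrightarrow> b = ?s \<or> b = ?t" if "i = 0"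
    using that by (auto simp: arrow_src_def arrow_tgt_def)
  have e: "map_option (\<lambda>(b, bs). b # bs) (eop (tensor ?L ?T) i (b, rev cs)) = map_option rev (row_e i as)"
  proof -
    consider (pos) "i < 0" | (zero) "i = 0" | (neg) "0 < i" by linarith
    then show ?thesis
    proof cases
      case pos
      have "eop (tensor ?L ?T) i (b, rev cs) =
         (if count (mset cs) ?t \<le> (if b = ?s then 1 else 0) then if b = ?t then Some (?s, rev cs) else None
          else map_option (\<lambda>y. (b, rev y)) (row_e i cs))"
        using pos by (auto simp: tensor_def on_fst_def on_snd_def letter_eps_phi[OF assms(3)] eps ops letL
            row_eps_def option.map_comp comp_def simp del: tensor_power.simps)
      then show ?thesis
        using pos st no_t s_le first_e rest[of ?t ?s]
        by (cases "?t \<in> set cs"; cases "b = ?s"; cases "b = ?t")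
          (simp_all add: row_e_def set_as count_t)
    next
      case neg
      have "eop (tensor ?L ?T) i (b, rev cs) =
         (if (if b = ?t then 1 else 0) \<le> row_phi i cs then map_option (\<lambda>y. (b, rev y)) (row_e i cs)
          else if b = ?t then Some (?s, rev cs) else None)"
        using neg by (auto simp: tensor_def on_fst_def on_snd_def letter_eps_phi[OF assms(3)] phi ops letL
            option.map_comp comp_def simp del: tensor_power.simps)
      then show ?thesis
        using neg st no_t s_le first_e rest[of ?t ?s] new'
        by (cases "?t \<in> set cs"; cases "?s \<in> set cs"; cases "b = ?s"; cases "b = ?t")
          (simp_all add: row_e_def row_phi_def set_as)
    next
      case zero
      have "eop (tensor ?L ?T) i (b, rev cs) = (if h0_pairing (wt ?L b) > 0
         then on_fst (eop ?L i) (b, rev cs) else on_snd (eop ?T i) (b, rev cs))"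
        using zero by (simp add: tensor_def del: tensor_power.simps)
      also have "\<dots> =
         (if b = ?s \<or> b = ?t then if b = ?t then Some (?s, rev cs) else None
          else map_option (\<lambda>y. (b, rev y)) (row_e i cs))"
        unfolding wtL sign0[OF zero]
        by (simp add: on_fst_def on_snd_def ops letL option.map_comp comp_def del: tensor_power.simps)
      finally show ?thesis
        using zero st no_t s_le first_e rest[of ?t ?s] new'
        by (cases "?t \<in> set cs"; cases "b = ?s"; cases "b = ?t")
          (simp_all add: row_e_def set_as)
    qed
  qed
  have f: "map_option (\<lambda>(b, bs). b # bs) (fop (tensor ?L ?T) i (b, rev cs)) = map_option rev (row_f i as)"
  proof -
    consider (pos) "i < 0" | (zero) "i = 0" | (neg) "0 < i" by linarith
    then show ?thesis
    proof cases
      case pos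
      have "fop (tensor ?L ?T) i (b, rev cs) =
         (if count (mset cs) ?t < (if b = ?s then 1 else 0) then if b = ?s then Some (?t, rev cs) else None
          else map_option (\<lambda>y. (b, rev y)) (row_f i cs))"
        using pos by (auto simp: tensor_def on_fst_def on_snd_def letter_eps_phi[OF assms(3)] eps ops letL
            row_eps_def option.map_comp comp_def simp del: tensor_power.simps)
      then show ?thesis
        using pos st no_t t_le first_f rest[of ?s ?t]
        by (cases "?s \<in> set cs"; cases "b = ?s"; cases "b = ?t")
          (simp_all add: row_f_def set_as count_t)
    next
      case neg
      have "fop (tensor ?L ?T) i (b, rev cs) =
         (if (if b = ?t then 1 else 0) < row_phi i cs then map_option (\<lambda>y. (b, rev y)) (row_f i cs)
          else if b = ?s then Some (?t, rev cs) else None)"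
        using neg by (auto simp: tensor_def on_fst_def on_snd_def letter_eps_phi[OF assms(3)] phi ops letL
            option.map_comp comp_def simp del: tensor_power.simps)
      then show ?thesis
        using neg st no_t t_le first_f rest[of ?s ?t] new' new
        by (cases "?t \<in> set cs"; cases "?s \<in> set cs"; cases "b = ?s"; cases "b = ?t")
          (simp_all add: row_f_def row_phi_def set_as arrow_src_def)
    next
      case zero
      have "fop (tensor ?L ?T) i (b, rev cs) = (if h0_pairing (wt ?L b) > 0
         then on_fst (fop ?L i) (b, rev cs) else on_snd (fop ?T i) (b, rev cs))"
        using zero by (simp add: tensor_def del: tensor_power.simps)
      also have "\<dots> =
         (if b = ?s \<or> b = ?t then if b = ?s then Some (?t, rev cs) else None
          else map_option (\<lambda>y. (b, rev y)) (row_f i cs))"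
        unfolding wtL sign0[OF zero]
        by (simp add: on_fst_def on_snd_def ops letL option.map_comp comp_def del: tensor_power.simps)
      finally show ?thesis
        using zero st no_t t_le first_f rest[of ?s ?t] new'
        by (cases "?t \<in> set cs"; cases "?s \<in> set cs"; cases "b = ?s"; cases "b = ?t")
          (simp_all add: row_f_def set_as)
    qed
  qed
  show ?case unfolding eopT fopT using e f by blast
qed

lemma tensor_power_wt:
  "length w = r \<Longrightarrow> wt (tensor_power (letter_crystal m n) r) w c = int (count (mset w) c)"
proof (induction "letter_crystal m n" r arbitrary: w rule: tensor_power.induct)
  case (3 r)
  then obtain b v where "w = b # v" "length v = Suc r" by (cases w) auto
  then show ?case using 3(1)[of v]
    by (auto simp: transport_def tensor_def letter_crystal_def simp del: tensor_power.simps(2))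
qed (auto simp: transport_def letter_crystal_def length_Suc_conv)

lemma row_crystal_elems: "elems (row_crystal m n r) = {as. length as = r \<and> semistandard_row m n as}"
  by (simp add: row_crystal_def)

lemma row_crystal_wt: "length as = r \<Longrightarrow> wt (row_crystal m n r) as c = int (count (mset as) c)"
  by (simp add: row_crystal_def transport_def tensor_power_wt)

lemma mem_of_count: "count (mset as) x = Suc k \<Longrightarrow> x \<in> set as"
  by (metis count_inI nat.distinct(1) set_mset_mset)

section \<open>Tensor products of a row and a letter\<close>

locale row_crystal_index =
  fixes m n :: int and r :: nat and i :: int
  assumes m: "m \<ge> 1" and n: "n \<ge> 1" and r: "r \<ge> 1" and i: "i \<in> indices m n"
begin

abbreviation "L \<equiv> letter_crystal m n"
abbreviation "R \<equiv> row_crystal m n r"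
abbreviation "s \<equiv> arrow_src i"
abbreviation "t \<equiv> arrow_tgt i"

lemma row_ops:
  assumes "as \<in> elems R"
  shows "eop R i as = row_e i as" "fop R i as = row_f i as"
proof -
  obtain r' where "r = Suc r'" using r by (cases r) auto
  then show "eop R i as = row_e i as" "fop R i as = row_f i as"
    using tensor_power_row[OF m n i, of as r'] assms
    by (auto simp: row_crystal_elems row_crystal_def transport_def option.map_comp comp_def
        option.map_ident simp del: tensor_power.simps)
qed

lemma row_eps_phi:
  assumes "as \<in> elems R" "i \<noteq> 0"
  shows "eps R i as = row_eps i as" "phi R i as = row_phi i as"
  using eps_of_row_e[OF m n i assms(2), of "\<lambda>x. x" r R as] phi_of_row_f[OF m n i assms(2), of "\<lambda>x. x" r R as]
    row_ops assms(1)
  by (auto simp: row_crystal_elems option.map_ident)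

lemma letter_ops:
  "eop L i b = (if b = t then Some s else None)" "fop L i b = (if b = s then Some t else None)"
  using i by (auto simp: letter_crystal_def)

lemma letter_h0: "i = 0 \<Longrightarrow> h0_pairing (wt L b) > 0 \<longleftrightarrow> b = s \<or> b = t"
  by (auto simp: h0_pairing_def letter_crystal_def arrow_src_def arrow_tgt_def)

lemma row_h0:
  assumes "as \<in> elems R" "i = 0"
  shows "h0_pairing (wt R as) > 0 \<longleftrightarrow> s \<in> set as \<or> t \<in> set as"
proof -
  have "h0_pairing (wt R as) = int (count (mset as) s + count (mset as) t)"
    using assms by (simp add: h0_pairing_def row_crystal_elems row_crystal_wt arrow_src_def arrow_tgt_def)
  moreover have "0 < int (p + q) \<longleftrightarrow> 0 < p \<or> 0 < q" for p q
    by linarith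
  ultimately show ?thesis by simp
qed

text \<open>
The tensor product rule compares string lengths. In the next four formulas, for a row and a letter
in either order, the comparison is merged with the condition that the chosen factor can move, so
that the occurrences of \<open>s\<close> and \<open>t\<close> decide directly which factor moves.
\<close>
lemma row_letter_f:
  assumes "as \<in> elems R"
  shows "fop (tensor R L) i (as, b) =
    (if (if i < 0 then s \<in> set as \<and> (b = t \<longrightarrow> 2 \<le> count (mset as) s)
         else if i = 0 then s \<in> set as \<and> t \<notin> set as
         else s \<in> set as \<and> t \<notin> set as \<and> b \<noteq> s)
     then Some (replace s t as, b)
     else if b = s \<and> (if i < 0 then s \<notin> set as
         else if i = 0 then s \<notin> set as \<and> t \<notin> set as
         else t \<in> set as \<longrightarrow> s \<in> set as)
     then Some (as, t) else None)"
proof -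
  consider "i < 0" | "i = 0" | "0 < i" by linarith
  then show ?thesis
  proof cases
    case 1
    then show ?thesis using arrow_less[of i]
      by (cases "count (mset as) s"; cases "s \<in> set as"; cases "b = s")
       (auto simp: tensor_def on_fst_def on_snd_def row_eps_phi[OF assms] row_ops[OF assms]
         letter_eps_phi[OF i] letter_ops row_f_def row_phi_def dest: mem_of_count)
  next
    case 2
    have "fop (tensor R L) i (as, b) = (if h0_pairing (wt R as) > 0
         then on_fst (fop R i) (as, b) else on_snd (fop L i) (as, b))"
      using 2 by (simp add: tensor_def)
    also have "\<dots> = (if s \<in> set as \<or> t \<in> set as then map_option (\<lambda>x. (x, b)) (row_f i as)
        else if b = s then Some (as, t) else None)"
      unfolding row_h0[OF assms 2] by (simp add: on_fst_def on_snd_def row_ops[OF assms] letter_ops)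
    finally show ?thesis using 2 by (auto simp: row_f_def)
  next
    case 3
    then show ?thesis using arrow_less[of i]
      by (cases "t \<in> set as"; cases "s \<in> set as"; cases "b = s")
       (auto simp: tensor_def on_fst_def on_snd_def row_eps_phi[OF assms] row_ops[OF assms]
         letter_eps_phi[OF i] letter_ops row_f_def row_eps_def dest: mem_of_count)
  qed
qed

lemma row_letter_e:
  assumes "as \<in> elems R"
  shows "eop (tensor R L) i (as, b) =
    (if (if i < 0 then t \<in> set as \<and> (b = t \<longrightarrow> s \<in> set as)
         else if i = 0 then t \<in> set as
         else t \<in> set as \<and> s \<notin> set as \<and> b \<noteq> s)
     then Some (replace t s as, b)
     else if b = t \<and> (if i < 0 then s \<notin> set as
         else if i = 0 then s \<notin> set as \<and> t \<notin> set as
         else t \<in> set as \<longrightarrow> s \<in> set as)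
     then Some (as, s) else None)"
proof -
  consider "i < 0" | "i = 0" | "0 < i" by linarith
  then show ?thesis
  proof cases
    case 1
    then show ?thesis using arrow_less[of i]
      by (cases "count (mset as) s"; cases "s \<in> set as"; cases "b = t")
       (auto simp: tensor_def on_fst_def on_snd_def row_eps_phi[OF assms] row_ops[OF assms]
         letter_eps_phi[OF i] letter_ops row_e_def row_phi_def dest: mem_of_count)
  next
    case 2
    have "eop (tensor R L) i (as, b) = (if h0_pairing (wt R as) > 0
         then on_fst (eop R i) (as, b) else on_snd (eop L i) (as, b))"
      using 2 by (simp add: tensor_def)
    also have "\<dots> = (if s \<in> set as \<or> t \<in> set as then map_option (\<lambda>x. (x, b)) (row_e i as)
        else if b = t then Some (as, s) else None)"
      unfolding row_h0[OF assms 2] by (simp add: on_fst_def on_snd_def row_ops[OF assms] letter_ops)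
    finally show ?thesis using 2 by (auto simp: row_e_def)
  next
    case 3
    then show ?thesis using arrow_less[of i]
      by (cases "t \<in> set as"; cases "s \<in> set as"; cases "b = s")
       (auto simp: tensor_def on_fst_def on_snd_def row_eps_phi[OF assms] row_ops[OF assms]
         letter_eps_phi[OF i] letter_ops row_e_def row_eps_def dest: mem_of_count)
  qed
qed

lemma letter_row_f:
  assumes "as \<in> elems R"
  shows "fop (tensor L R) i (a, as) =
    (if a = s \<and> (if i < 0 then t \<notin> set as
         else if i = 0 then True
         else s \<in> set as \<longrightarrow> t \<in> set as)
     then Some (t, as)
     else if (if i < 0 then s \<in> set as
         else if i = 0 then a \<noteq> s \<and> a \<noteq> t \<and> s \<in> set as \<and> t \<notin> set as
         else a \<noteq> t \<and> s \<in> set as \<and> t \<notin> set as)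
     then Some (a, replace s t as) else None)"
proof -
  consider "i < 0" | "i = 0" | "0 < i" by linarith
  then show ?thesis
  proof cases
    case 1
    then show ?thesis using arrow_less[of i]
      by (cases "count (mset as) t"; cases "t \<in> set as"; cases "a = s")
       (auto simp: tensor_def on_fst_def on_snd_def row_eps_phi[OF assms] row_ops[OF assms]
         letter_eps_phi[OF i] letter_ops row_f_def row_eps_def dest: mem_of_count)
  next
    case 2
    have "fop (tensor L R) i (a, as) = (if h0_pairing (wt L a) > 0
         then on_fst (fop L i) (a, as) else on_snd (fop R i) (a, as))"
      using 2 by (simp add: tensor_def)
    also have "\<dots> = (if a = s \<or> a = t then if a = s then Some (t, as) else None
         else map_option (\<lambda>x. (a, x)) (row_f i as))"
      unfolding letter_h0[OF 2] by (simp add: on_fst_def on_snd_def row_ops[OF assms] letter_ops)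
    finally show ?thesis using 2 by (auto simp: row_f_def)
  next
    case 3
    then show ?thesis using arrow_less[of i]
      by (cases "t \<in> set as"; cases "s \<in> set as"; cases "a = s"; cases "a = t")
       (auto simp: tensor_def on_fst_def on_snd_def row_eps_phi[OF assms] row_ops[OF assms]
         letter_eps_phi[OF i] letter_ops row_f_def row_phi_def dest: mem_of_count)
  qed
qed

lemma letter_row_e:
  assumes "as \<in> elems R"
  shows "eop (tensor L R) i (a, as) =
    (if a = t \<and> (if i < 0 then t \<notin> set as
         else if i = 0 then True
         else s \<in> set as \<longrightarrow> t \<in> set as)
     then Some (s, as)
     else if (if i < 0 then t \<in> set as \<and> (a = s \<longrightarrow> 2 \<le> count (mset as) t)
         else if i = 0 then a \<noteq> s \<and> a \<noteq> t \<and> t \<in> set as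
         else a \<noteq> t \<and> t \<in> set as \<and> s \<notin> set as)
     then Some (a, replace t s as) else None)"
proof -
  consider "i < 0" | "i = 0" | "0 < i" by linarith
  then show ?thesis
  proof cases
    case 1
    then show ?thesis using arrow_less[of i]
      by (cases "count (mset as) t"; cases "t \<in> set as"; cases "a = s")
       (auto simp: tensor_def on_fst_def on_snd_def row_eps_phi[OF assms] row_ops[OF assms]
         letter_eps_phi[OF i] letter_ops row_e_def row_eps_def dest: mem_of_count)
  next
    case 2
    have "eop (tensor L R) i (a, as) = (if h0_pairing (wt L a) > 0
         then on_fst (eop L i) (a, as) else on_snd (eop R i) (a, as))"
      using 2 by (simp add: tensor_def)
    also have "\<dots> = (if a = s \<or> a = t then if a = t then Some (s, as) else None
         else map_option (\<lambda>x. (a, x)) (row_e i as))"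
      unfolding letter_h0[OF 2] by (simp add: on_fst_def on_snd_def row_ops[OF assms] letter_ops)
    finally show ?thesis using 2 by (auto simp: row_e_def)
  next
    case 3
    then show ?thesis using arrow_less[of i]
      by (cases "t \<in> set as"; cases "s \<in> set as"; cases "a = s"; cases "a = t")
       (auto simp: tensor_def on_fst_def on_snd_def row_eps_phi[OF assms] row_ops[OF assms]
         letter_eps_phi[OF i] letter_ops row_e_def row_phi_def dest: mem_of_count)
  qed
qed

end

section \<open>Cyclic neighbours\<close>

text \<open>
For letters \<open>a\<close>, \<open>b\<close> this says that the column with \<open>a\<close> above \<open>b\<close> is semistandard; the
alternative is that the row with \<open>b\<close> left of \<open>a\<close> is.
\<close>
definition above :: "int \<Rightarrow> int \<Rightarrow> bool" where
  "above a b \<longleftrightarrow> a < b \<or> a = b \<and> 0 < a"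

text \<open>
For fixed \<open>b\<close> rotate the order of the letters, putting the letters that are not above \<open>b\<close> first and
those above \<open>b\<close> last, each group in its usual order. Then \<open>is_pred A b a\<close> says that \<open>a\<close> is the
maximum of \<open>A\<close> for this rotated order: the cyclic predecessor of \<open>b\<close> in \<open>A\<close>. It is the largest
element of \<open>A\<close> above \<open>b\<close>, or the largest element of \<open>A\<close> if none is above \<open>b\<close>. The cyclic
successor is described dually.
\<close>
definition is_pred :: "int set \<Rightarrow> int \<Rightarrow> int \<Rightarrow> bool" where
  "is_pred A b a \<longleftrightarrow> a \<in> A \<and> (\<forall>x\<in>A. (above x b \<longrightarrow> above a b \<and> x \<le> a) \<and> (above a b \<or> x \<le> a))"

definition is_succ :: "int set \<Rightarrow> int \<Rightarrow> int \<Rightarrow> bool" where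
  "is_succ A a b \<longleftrightarrow> b \<in> A \<and> (\<forall>x\<in>A. (above a x \<longrightarrow> above a b \<and> b \<le> x) \<and> (above a b \<or> b \<le> x))"

lemma is_pred_unique: "is_pred A b a \<Longrightarrow> is_pred A b a' \<Longrightarrow> a = a'"
  unfolding is_pred_def by (meson order_antisym)

lemma is_succ_unique: "is_succ A a b \<Longrightarrow> is_succ A a b' \<Longrightarrow> b = b'"
  unfolding is_succ_def by (meson order_antisym)

lemma is_pred_exists:
  assumes "finite A" "A \<noteq> {}"
  shows "\<exists>a. is_pred A b a"
proof (cases "\<exists>x\<in>A. above x b")
  case True
  then have "Max {x\<in>A. above x b} \<in> {x\<in>A. above x b}"
    using assms by (intro Max_in) auto
  moreover have "x \<le> Max {x\<in>A. above x b}" if "x \<in> A" "above x b" for x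
    using assms that by (intro Max_ge) auto
  ultimately show ?thesis unfolding is_pred_def by blast
next
  case False
  then show ?thesis using assms by (intro exI[of _ "Max A"]) (auto simp: is_pred_def)
qed

lemma is_succ_exists:
  assumes "finite A" "A \<noteq> {}"
  shows "\<exists>b. is_succ A a b"
proof (cases "\<exists>x\<in>A. above a x")
  case True
  then have "Min {x\<in>A. above a x} \<in> {x\<in>A. above a x}"
    using assms by (intro Min_in) auto
  moreover have "Min {x\<in>A. above a x} \<le> x" if "x \<in> A" "above a x" for x
    using assms that by (intro Min_le) auto
  ultimately show ?thesis unfolding is_succ_def by blast
next
  case False
  then show ?thesis using assms by (intro exI[of _ "Min A"]) (auto simp: is_succ_def)
qed

section \<open>The exchange map\<close>

text \<open>
The incoming letter \<open>b\<close> takes the place of its cyclic predecessor in the row, and the latter leaves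
the row.
\<close>
definition exchange :: "int list \<times> int \<Rightarrow> int \<times> int list" where
  "exchange = (\<lambda>(as, b). let a = THE a. is_pred (set as) b a in (a, replace a b as))"

definition exchange_inv :: "int \<times> int list \<Rightarrow> int list \<times> int" where
  "exchange_inv = (\<lambda>(a, as). let b = THE b. is_succ (set as) a b in (replace b a as, b))"

lemma exchange_eq: "is_pred (set as) b a \<Longrightarrow> exchange (as, b) = (a, replace a b as)"
  unfolding exchange_def using is_pred_unique by (simp add: the_equality[of _ a])

lemma exchange_inv_eq: "is_succ (set as) a b \<Longrightarrow> exchange_inv (a, as) = (replace b a as, b)"
  unfolding exchange_inv_def using is_succ_unique by (simp add: the_equality[of _ b])

lemma replace_eq_of_content:
  assumes "x \<in> set as" "sorted as" "sorted bs" "add_mset x (mset bs) = add_mset y (mset as)"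
  shows "bs = replace x y as"
proof (rule replace_eqI)
  have "mset bs = add_mset y (mset as) - {#x#}"
    by (metis assms(4) add_mset_remove_trivial)
  then show "mset bs = add_mset y (mset as - {#x#})"
    using assms(1) by simp
qed fact+

text \<open>
The set of entries of a row after one occurrence of \<open>x\<close> has become \<open>y\<close>, when \<open>A\<close> is the set of
entries and \<open>D\<close> the set of repeated entries. Recording multiplicities by the set \<open>D\<close> alone keeps
the case analysis first-order.
\<close>
definition replaced :: "int set \<Rightarrow> int set \<Rightarrow> int \<Rightarrow> int \<Rightarrow> int set" where
  "replaced A D x y = insert y {z \<in> A. z = x \<longrightarrow> z \<in> D}"

lemma mem_replaced: "z \<in> replaced A D x y \<longleftrightarrow> z = y \<or> z \<in> A \<and> (z = x \<longrightarrow> z \<in> D)"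
  by (auto simp: replaced_def)

definition repeated :: "int list \<Rightarrow> int set" where
  "repeated as = {x. 2 \<le> count (mset as) x}"

lemma set_replace_repeated: "x \<in> set as \<Longrightarrow> set (replace x y as) = replaced (set as) (repeated as) x y"
  by (auto simp: mem_replace replaced_def repeated_def)

text \<open>
This collects what has to be checked for an operator that turns a letter \<open>u\<close> into its neighbour \<open>v\<close>
to commute with the exchange map at a row with entries \<open>A\<close> and a letter \<open>b\<close> with predecessor \<open>a\<close>.
The conditions \<open>xr\<close>, \<open>xl\<close> tell whether the operator moves the row or the letter before the exchange,
and \<open>yl\<close>, \<open>yr\<close> whether it moves the letter or the row after it; the first condition of each pair
takes precedence. Since both sides keep the same total content, only the outgoing letter remains to
be compared: in each combination it must be the predecessor of the incoming one.
\<close>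
definition compatible ::
    "int set \<Rightarrow> int set \<Rightarrow> int \<Rightarrow> int \<Rightarrow> int \<Rightarrow> int \<Rightarrow> bool \<Rightarrow> bool \<Rightarrow> bool \<Rightarrow> bool \<Rightarrow> bool" where
  "compatible A D a b u v xr xl yl yr \<longleftrightarrow>
     (xr \<or> xl \<longleftrightarrow> yl \<or> yr) \<and>
     (xr \<longrightarrow> yl \<longrightarrow> is_pred (replaced A D u v) b v) \<and>
     (xr \<longrightarrow> \<not> yl \<longrightarrow> is_pred (replaced A D u v) b a) \<and>
     (\<not> xr \<longrightarrow> xl \<longrightarrow> yl \<longrightarrow> is_pred A v v) \<and>
     (\<not> xr \<longrightarrow> xl \<longrightarrow> \<not> yl \<longrightarrow> is_pred A v a)"

text \<open>
Before and after the operator acts, the two sides of the exchange contain the same letters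
altogether: \<open>X\<close> before, and \<open>X\<close> with one \<open>u\<close> turned into \<open>v\<close> afterwards. So as soon as the
outgoing letter is right, the row is right as well.
\<close>
lemma exchange_commutes:
  assumes x: "x = (if xr then Some (replace u v as, b) else if xl then Some (as, v) else None)"
    and y: "y = (if yl then Some (v, as') else if yr then Some (a, replace u v as') else None)"
    and compatible: "compatible (set as) (repeated as) a b u v xr xl yl yr"
    and as: "sorted as" "a \<in> set as" and as': "as' = replace a b as"
    and xr: "xr \<Longrightarrow> u \<in> set as" and xl: "xl \<Longrightarrow> b = u"
    and yl: "yl \<Longrightarrow> a = u" and yr: "yr \<Longrightarrow> u \<in> set as'"
  shows "y = map_option exchange x"
proof -
  define X where "X = add_mset b (mset as)"
  have content': "add_mset a (mset as') = X"
    using as(2) by (simp add: as' X_def add_mset_commute)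
  have xr_c: "add_mset b (mset (replace u v as)) = add_mset v (X - {#u#})" if xr
    using xr[OF that] by (simp add: X_def add_mset_commute)
  have xl_c: "add_mset v (mset as) = add_mset v (X - {#u#})" if xl
    using xl[OF that] by (simp add: X_def)
  have yl_c: "add_mset v (mset as') = add_mset v (X - {#u#})" if yl
    using yl[OF that] content' by (metis add_mset_remove_trivial)
  have yr_c: "add_mset a (mset (replace u v as')) = add_mset v (X - {#u#})" if yr
    using yr[OF that] by (simp add: content'[symmetric] add_mset_commute)
  have srt: "sorted as" "sorted as'" "sorted (replace u v as)" "sorted (replace u v as')"
    using as(1) by (auto simp: as' sorted_replace)
  have both: "exchange (as1, b1) = (a1, bs1)"
    if "is_pred (set as1) b1 a1" "add_mset b1 (mset as1) = add_mset v (X - {#u#})"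
      "add_mset a1 (mset bs1) = add_mset v (X - {#u#})" "sorted as1" "sorted bs1" for as1 b1 a1 bs1
    using that exchange_eq[OF that(1)] replace_eq_of_content[of a1 as1 bs1 b1] by (simp add: is_pred_def)
  note pred = compatible[unfolded compatible_def]
  consider "xr" "yl" | "xr" "\<not> yl" "yr" | "\<not> xr" "xl" "yl" | "\<not> xr" "xl" "\<not> yl" "yr"
    | "\<not> xr" "\<not> xl" "\<not> yl" "\<not> yr"
    using pred by blast
  then show ?thesis
  proof cases
    case 1
    then have "is_pred (set (replace u v as)) b v"
      using pred xr by (simp add: set_replace_repeated)
    then show ?thesis
      using 1 both[OF _ xr_c yl_c srt(3) srt(2)] by (simp add: x y)
  next
    case 2
    then have "is_pred (set (replace u v as)) b a"
      using pred xr by (simp add: set_replace_repeated)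
    then show ?thesis
      using 2 both[OF _ xr_c yr_c srt(3) srt(4)] by (simp add: x y)
  next
    case 3
    then show ?thesis
      using pred both[OF _ xl_c yl_c srt(1) srt(2)] by (simp add: x y)
  next
    case 4
    then show ?thesis
      using pred both[OF _ xl_c yr_c srt(1) srt(4)] by (simp add: x y)
  next
    case 5
    then show ?thesis by (simp add: x y)
  qed
qed

text \<open>
The successor undoes the predecessor: once \<open>a\<close> has been replaced by \<open>b\<close>, no entry lies cyclically
between \<open>a\<close> and \<open>b\<close>, since such an entry would have been a better predecessor of \<open>b\<close>. An entry equal
to \<open>a\<close> does not interfere either, because a repeated letter is negative, hence not above itself.
\<close>
lemma is_succ_replaced:
  assumes "is_pred A b a" "D \<subseteq> {..<0}"
  shows "is_succ (replaced A D a b) a b"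
  using assms unfolding is_pred_def is_succ_def above_def Ball_def mem_replaced subset_iff lessThan_iff
  by smt

lemma is_pred_replaced:
  assumes "is_succ A a b" "D \<subseteq> {..<0}"
  shows "is_pred (replaced A D b a) b a"
  using assms unfolding is_pred_def is_succ_def above_def Ball_def mem_replaced subset_iff lessThan_iff
  by smt

section \<open>Compatibility of predecessors with moving one letter\<close>

text \<open>
Here \<open>s\<close> and \<open>t\<close> are consecutive letters, so every other letter compares with \<open>s\<close> as it does with
\<open>t\<close>. In the order rotated at \<open>b\<close>, the letter \<open>t\<close> therefore comes right after \<open>s\<close>, unless the cut
falls between them; this happens for \<open>b = t\<close> if both are negative, for \<open>b = s\<close> if both are
positive, and never if they have opposite signs.

If the cut is elsewhere, replacing one of \<open>s\<close>, \<open>t\<close> by the other in the row can change the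
predecessor of \<open>b\<close> only in the same way, and this is when the operator moves the outgoing letter
after the exchange. If the cut separates \<open>s\<close> from \<open>t\<close>, then \<open>s\<close>, if present, is the predecessor of
\<open>b\<close>, while \<open>t\<close> is the predecessor only if there is no other entry. If \<open>b\<close> itself moves, the cut
moves by at most one step. What remains is a comparison of \<open>a\<close>, \<open>b\<close> with \<open>s\<close>, \<open>t\<close>, carried out
separately for each operator and for the three sign patterns of \<open>s\<close>, \<open>t\<close>.
\<close>
locale adjacent_letters =
  fixes A D :: "int set" and a b s t :: int
  assumes pred: "is_pred A b a"
    \<comment> \<open>only letters of \<open>B_+\<close> repeat in a row\<close>
    and D: "\<And>x. x \<in> D \<Longrightarrow> x \<in> A \<and> x < 0"
    and less: "s < t"
    and gap: "\<And>x. x \<in> A \<Longrightarrow> x \<le> s \<or> t \<le> x" "b \<le> s \<or> t \<le> b"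
begin

abbreviation "A' \<equiv> replaced A D a b"

lemmas facts = pred D less gap
lemmas unfolds = compatible_def is_pred_def above_def Ball_def mem_replaced

lemma compatible_f_pos:
  assumes "t < 0"
  shows "compatible A D a b s t
    (s \<in> A \<and> (b = t \<longrightarrow> s \<in> D)) (b = s \<and> s \<notin> A)
    (a = s \<and> t \<notin> A') (s \<in> A')"
  using facts assms unfolding unfolds by smt

lemma compatible_f_zero:
  assumes "s < 0" "0 < t"
  shows "compatible A D a b s t
    (s \<in> A \<and> t \<notin> A) (b = s \<and> s \<notin> A \<and> t \<notin> A)
    (a = s) (a \<noteq> s \<and> a \<noteq> t \<and> s \<in> A' \<and> t \<notin> A')"
  using facts assms unfolding unfolds by smt

lemma compatible_f_neg:
  assumes "0 < s"
  shows "compatible A D a b s t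
    (s \<in> A \<and> t \<notin> A \<and> b \<noteq> s) (b = s \<and> (t \<in> A \<longrightarrow> s \<in> A))
    (a = s \<and> (s \<in> A' \<longrightarrow> t \<in> A')) (a \<noteq> t \<and> s \<in> A' \<and> t \<notin> A')"
  using facts assms unfolding unfolds by smt

lemma compatible_e_pos:
  assumes "t < 0"
  shows "compatible A D a b t s
    (t \<in> A \<and> (b = t \<longrightarrow> s \<in> A)) (b = t \<and> s \<notin> A)
    (a = t \<and> t \<notin> A') (t \<in> A' \<and> (a = s \<longrightarrow> (if b = t then t \<in> A else t \<in> D)))"
  using facts assms unfolding unfolds by smt

lemma compatible_e_zero:
  assumes "s < 0" "0 < t"
  shows "compatible A D a b t s
    (t \<in> A) (b = t \<and> s \<notin> A \<and> t \<notin> A)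
    (a = t) (a \<noteq> s \<and> a \<noteq> t \<and> t \<in> A')"
  using facts assms unfolding unfolds by smt

lemma compatible_e_neg:
  assumes "0 < s"
  shows "compatible A D a b t s
    (t \<in> A \<and> s \<notin> A \<and> b \<noteq> s) (b = t \<and> (t \<in> A \<longrightarrow> s \<in> A))
    (a = t \<and> (s \<in> A' \<longrightarrow> t \<in> A')) (a \<noteq> t \<and> t \<in> A' \<and> s \<notin> A')"
  using facts assms unfolding unfolds by smt

end

section \<open>Commutation with the crystal operators\<close>

context row_crystal_index
begin

lemma exchange_elem:
  assumes "as \<in> elems R" "b \<in> elems L" "is_pred (set as) b a"
  shows "replace a b as \<in> elems R"
proof -
  have "a \<in> set as" and "0 < b \<Longrightarrow> b \<in> set as \<Longrightarrow> a = b"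
    using assms(3) by (force simp: is_pred_def above_def)+
  then show ?thesis
    using assms(1,2) semistandard_row_replace[of m n as b a]
    by (simp add: row_crystal_elems letter_crystal_def length_replace)
qed

lemma exchange_inv_elem:
  assumes "as \<in> elems R" "a \<in> elems L" "is_succ (set as) a b"
  shows "replace b a as \<in> elems R"
proof -
  have "b \<in> set as" and "0 < a \<Longrightarrow> a \<in> set as \<Longrightarrow> b = a"
    using assms(3) by (force simp: is_succ_def above_def)+
  then show ?thesis
    using assms(1,2) semistandard_row_replace[of m n as a b]
    by (simp add: row_crystal_elems letter_crystal_def length_replace)
qed

lemma repeated_neg:
  assumes "as \<in> elems R" "x \<in> repeated as"
  shows "x \<in> set as \<and> x < 0"
proof -
  have "2 \<le> count (mset as) x" using assms(2) by (simp add: repeated_def)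
  then have "x \<in># mset as" by (intro count_inI) simp
  then have "x \<in> set as" by simp
  moreover have "count (mset as) x \<le> 1" if "0 < x"
    using assms(1) that by (simp add: row_crystal_elems semistandard_row_iff)
  moreover have "x \<noteq> 0"
    using assms(1) \<open>x \<in> set as\<close>
    by (auto simp: row_crystal_elems semistandard_row_iff letters_def letters_pos_def letters_neg_def)
  ultimately show ?thesis using \<open>2 \<le> count (mset as) x\<close> by linarith
qed

text \<open>
The formulas for the operators on both tensor products have the shape required by
\<open>exchange_commutes\<close>, with the conditions matching the six compatibility statements.
\<close>
lemma exchange_commutes_with_operators:
  assumes as: "as \<in> elems R" and b: "b \<in> elems L"
  shows "eop (tensor L R) i (exchange (as, b)) = map_option exchange (eop (tensor R L) i (as, b))"
    and "fop (tensor L R) i (exchange (as, b)) = map_option exchange (fop (tensor R L) i (as, b))"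
proof -
  have "set as \<noteq> {}" using as r by (auto simp: row_crystal_elems)
  then obtain a where pred: "is_pred (set as) b a"
    using is_pred_exists by blast
  define as' where "as' = replace a b as"
  have as'_in: "as' \<in> elems R" and a: "a \<in> set as"
    unfolding as'_def using exchange_elem[OF as b pred] pred by (auto simp: is_pred_def)
  have srt: "sorted as" and lets: "set as \<subseteq> letters m n"
    using as by (auto simp: row_crystal_elems semistandard_row_iff)
  interpret adjacent_letters "set as" "repeated as" a b s t
  proof
    show "s < t" by (rule arrow_less)
    show "x \<le> s \<or> t \<le> x" if "x \<in> set as" for x
      using arrow_covers[of x m n i] lets that by blast
    show "b \<le> s \<or> t \<le> b"
      using arrow_covers[of b m n i] b by (simp add: letter_crystal_def)
  qed (use pred repeated_neg[OF as] in auto)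
  have set': "set as' = A'"
    unfolding as'_def by (rule set_replace_repeated[OF a])
  have repeated_s: "2 \<le> count (mset as) s \<longleftrightarrow> s \<in> repeated as"
    by (simp add: repeated_def)
  \<comment> \<open>if \<open>a = s\<close>, the exchange takes no \<open>t\<close> out of the row, and puts one in only for \<open>b = t\<close>\<close>
  have twice: "(a = s \<longrightarrow> 2 \<le> count (mset as') t) \<longleftrightarrow>
      (a = s \<longrightarrow> (if b = t then t \<in> set as else t \<in> repeated as))"
    using arrow_less[of i] by (auto simp: as'_def repeated_def)
  have sign:
    "i < 0 \<Longrightarrow> (if i < 0 then p else if i = 0 then q else q') = p"
    "i = 0 \<Longrightarrow> (if i < 0 then p else if i = 0 then q else q') = q"
    "0 < i \<Longrightarrow> (if i < 0 then p else if i = 0 then q else q') = q'" for p q q' :: bool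
    by auto
  have arrow_sign:
    "i < 0 \<Longrightarrow> t < 0" "i = 0 \<Longrightarrow> s < 0" "i = 0 \<Longrightarrow> 0 < t" "0 < i \<Longrightarrow> 0 < s"
    by (auto simp: arrow_src_def arrow_tgt_def)
  have ex: "exchange (as, b) = (a, as')"
    unfolding as'_def by (rule exchange_eq[OF pred])
  consider "i < 0" | "i = 0" | "0 < i" by linarith
  then have "compatible (set as) (repeated as) a b s t
    (if i < 0 then s \<in> set as \<and> (b = t \<longrightarrow> 2 \<le> count (mset as) s)
         else if i = 0 then s \<in> set as \<and> t \<notin> set as
         else s \<in> set as \<and> t \<notin> set as \<and> b \<noteq> s)
    (b = s \<and> (if i < 0 then s \<notin> set as
         else if i = 0 then s \<notin> set as \<and> t \<notin> set as
         else t \<in> set as \<longrightarrow> s \<in> set as))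
    (a = s \<and> (if i < 0 then t \<notin> set as'
         else if i = 0 then True
         else s \<in> set as' \<longrightarrow> t \<in> set as'))
    (if i < 0 then s \<in> set as'
         else if i = 0 then a \<noteq> s \<and> a \<noteq> t \<and> s \<in> set as' \<and> t \<notin> set as'
         else a \<noteq> t \<and> s \<in> set as' \<and> t \<notin> set as')"
  proof cases
    case 1
    show ?thesis using compatible_f_pos[OF arrow_sign(1)[OF 1]] by (simp only: sign(1)[OF 1] set' repeated_s)
  next
    case 2
    show ?thesis using compatible_f_zero[OF arrow_sign(2,3)[OF 2]] by (simp only: sign(2)[OF 2] set' simp_thms)
  next
    case 3
    show ?thesis using compatible_f_neg[OF arrow_sign(4)[OF 3]] by (simp only: sign(3)[OF 3] set')
  qed
  then show "fop (tensor L R) i (exchange (as, b)) = map_option exchange (fop (tensor R L) i (as, b))"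
    unfolding ex
    by (rule exchange_commutes[OF row_letter_f[OF as] letter_row_f[OF as'_in]])
      (use srt a in \<open>auto simp: as'_def split: if_splits\<close>)
  consider "i < 0" | "i = 0" | "0 < i" by linarith
  then have "compatible (set as) (repeated as) a b t s
    (if i < 0 then t \<in> set as \<and> (b = t \<longrightarrow> s \<in> set as)
         else if i = 0 then t \<in> set as
         else t \<in> set as \<and> s \<notin> set as \<and> b \<noteq> s)
    (b = t \<and> (if i < 0 then s \<notin> set as
         else if i = 0 then s \<notin> set as \<and> t \<notin> set as
         else t \<in> set as \<longrightarrow> s \<in> set as))
    (a = t \<and> (if i < 0 then t \<notin> set as'
         else if i = 0 then True
         else s \<in> set as' \<longrightarrow> t \<in> set as'))
    (if i < 0 then t \<in> set as' \<and> (a = s \<longrightarrow> 2 \<le> count (mset as') t)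
         else if i = 0 then a \<noteq> s \<and> a \<noteq> t \<and> t \<in> set as'
         else a \<noteq> t \<and> t \<in> set as' \<and> s \<notin> set as')"
  proof cases
    case 1
    show ?thesis using compatible_e_pos[OF arrow_sign(1)[OF 1]] by (simp only: sign(1)[OF 1] set' twice)
  next
    case 2
    show ?thesis using compatible_e_zero[OF arrow_sign(2,3)[OF 2]] by (simp only: sign(2)[OF 2] set' simp_thms)
  next
    case 3
    show ?thesis using compatible_e_neg[OF arrow_sign(4)[OF 3]] by (simp only: sign(3)[OF 3] set')
  qed
  then show "eop (tensor L R) i (exchange (as, b)) = map_option exchange (eop (tensor R L) i (as, b))"
    unfolding ex
    by (rule exchange_commutes[OF row_letter_e[OF as] letter_row_e[OF as'_in]])
      (use srt a in \<open>auto simp: as'_def split: if_splits\<close>)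
qed

lemma row_letter_closed:
  assumes x: "x \<in> elems (tensor R L)" and y: "eop (tensor R L) i x = Some y \<or> fop (tensor R L) i x = Some y"
  shows "y \<in> elems (tensor R L)"
proof -
  obtain as b where xe: "x = (as, b)" and as: "as \<in> elems R" and b: "b \<in> elems L"
    using x by (auto simp: tensor_def)
  have st: "s \<in> letters m n" "t \<in> letters m n" using arrow_letters[OF i m n] by auto
  have s_t: "replace s t as \<in> elems R" if "s \<in> set as" "0 \<le> i \<longrightarrow> t \<notin> set as"
    using that as st
    by (auto simp: row_crystal_elems length_replace arrow_tgt_def split: if_splits intro: semistandard_row_replace)
  have t_s: "replace t s as \<in> elems R" if "t \<in> set as" "0 < i \<longrightarrow> s \<notin> set as"
    using that as st
    by (auto simp: row_crystal_elems length_replace arrow_src_def split: if_splits intro: semistandard_row_replace)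
  have b': "b \<in> letters m n" using b by (simp add: letter_crystal_def)
  have in_tensor: "(bs, c) \<in> elems (tensor R L) \<longleftrightarrow> bs \<in> elems R \<and> c \<in> letters m n" for bs c
    by (simp add: tensor_def letter_crystal_def)
  from y consider (e) "eop (tensor R L) i (as, b) = Some y" | (f) "fop (tensor R L) i (as, b) = Some y"
    unfolding xe by blast
  then show ?thesis
  proof cases
    case e
    then have "y = (replace t s as, b) \<and> t \<in> set as \<and> (0 < i \<longrightarrow> s \<notin> set as) \<or> y = (as, s)"
      unfolding row_letter_e[OF as] by (simp split: if_splits)
    then show ?thesis
      using t_s as b' st by (auto simp: in_tensor)
  next
    case f
    then have "y = (replace s t as, b) \<and> s \<in> set as \<and> (0 \<le> i \<longrightarrow> t \<notin> set as) \<or> y = (as, t)"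
      unfolding row_letter_f[OF as] by (simp split: if_splits)
    then show ?thesis
      using s_t as b' st by (auto simp: in_tensor)
  qed
qed

end

section \<open>The isomorphism and its explicit form\<close>

text \<open>
Commutation with the operators passes to the inverse map. Closedness of \<open>C\<close> is needed because \<open>G\<close>
inverts \<open>F\<close> only on elements of \<open>C\<close>.
\<close>
lemma crystal_iso_inverse:
  assumes iso: "crystal_iso I C D F"
    and closed: "\<And>i x y. i \<in> I \<Longrightarrow> x \<in> elems C \<Longrightarrow> eop C i x = Some y \<or> fop C i x = Some y \<Longrightarrow> y \<in> elems C"
    and GF: "\<And>x. x \<in> elems C \<Longrightarrow> G (F x) = x"
  shows "crystal_iso I D C G"
proof -
  have bij: "bij_betw F (elems C) (elems D)" using iso by (simp add: crystal_iso_def)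
  have "G y \<in> elems C \<and> F (G y) = y" if y: "y \<in> elems D" for y
  proof -
    obtain x where "x \<in> elems C" "y = F x"
      using bij_betw_imp_surj_on[OF bij] y by blast
    then show ?thesis using GF by simp
  qed
  then have G_in: "\<And>y. y \<in> elems D \<Longrightarrow> G y \<in> elems C"
    and FG: "\<And>y. y \<in> elems D \<Longrightarrow> F (G y) = y"
    by blast+
  have "bij_betw G (elems D) (elems C)"
    by (rule bij_betw_byWitness[where f' = F]) (use G_in FG GF bij_betwE[OF bij] in auto)
  moreover have "wt C (G y) = wt D y" if "y \<in> elems D" for y
    using iso G_in[OF that] FG[OF that] by (metis crystal_iso_def)
  moreover have "eop C i (G y) = map_option G (eop D i y)" if "i \<in> I" "y \<in> elems D" for i y
  proof -
    have "eop D i y = map_option F (eop C i (G y))"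
      using iso that G_in[OF that(2)] FG[OF that(2)] by (metis crystal_iso_def)
    then show ?thesis
      using closed[OF that(1) G_in[OF that(2)]] GF by (cases "eop C i (G y)") auto
  qed
  moreover have "fop C i (G y) = map_option G (fop D i y)" if "i \<in> I" "y \<in> elems D" for i y
  proof -
    have "fop D i y = map_option F (fop C i (G y))"
      using iso that G_in[OF that(2)] FG[OF that(2)] by (metis crystal_iso_def)
    then show ?thesis
      using closed[OF that(1) G_in[OF that(2)]] GF by (cases "fop C i (G y)") auto
  qed
  ultimately show ?thesis by (simp add: crystal_iso_def)
qed

lemma semistandard_pair:
  assumes "x \<in> letters m n" "y \<in> letters m n"
  shows "semistandard_col m n [x, y] \<longleftrightarrow> above x y" "semistandard_row m n [y, x] \<longleftrightarrow> \<not> above x y"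
  using assms
  by (auto simp: semistandard_col_def semistandard_row_def above_def letters_def letters_pos_def letters_neg_def)

lemma replace_nth:
  assumes "sorted as" "k < length as" "\<And>j. j < k \<Longrightarrow> as ! j \<le> y" "\<And>j. k < j \<Longrightarrow> j < length as \<Longrightarrow> y \<le> as ! j"
  shows "replace (as ! k) y as = as[k := y]"
proof (rule replace_eqI[symmetric])
  show "sorted (as[k := y])"
    unfolding sorted_iff_nth_mono_less
    using assms by (auto simp: nth_list_update sorted_nth_mono)
qed (use assms in \<open>auto simp: mset_update\<close>)

text \<open>
If the first entry is not above \<open>b\<close>, no entry is, and the cyclic predecessor of \<open>b\<close> is the last
entry. Otherwise, the entries above \<open>b\<close> form an initial segment, and its last entry is the
predecessor; \<open>b\<close> can take its place without any shift. The statements on the inverse are dual.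
\<close>
lemma exchange_row:
  assumes "sorted as" "as \<noteq> []" "\<not> above (as ! 0) b"
  shows "exchange (as, b) = (last as, b # butlast as)"
proof -
  have first: "as ! 0 \<le> x" "x \<le> last as" if "x \<in> set as" for x
    using assms(1,2) that by (auto simp: in_set_conv_nth last_conv_nth sorted_nth_mono)
  have pred: "is_pred (set as) b (last as)"
    using first assms(2,3) by (force simp: is_pred_def above_def)
  have "add_mset (last as) (mset (b # butlast as)) = add_mset b (mset (butlast as @ [last as]))"
    by simp
  also have "\<dots> = add_mset b (mset as)" using assms(2) by simp
  finally have content: "add_mset (last as) (mset (b # butlast as)) = add_mset b (mset as)" .
  have "b \<le> x" if "x \<in> set as" for x
    using first(1)[OF that] assms(3) by (simp add: above_def)
  then have "sorted (b # butlast as)"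
    using assms(1) by (auto simp: sorted_butlast dest: in_set_butlastD)
  then have "b # butlast as = replace (last as) b as"
    using assms(1,2) content by (intro replace_eq_of_content) simp_all
  then show ?thesis using exchange_eq[OF pred] by simp
qed

lemma exchange_col:
  assumes "sorted as" "as \<noteq> []" "above (as ! 0) b"
  shows "let \<nu> = Max {k. k < length as \<and> above (as ! k) b} in exchange (as, b) = (as ! \<nu>, as[\<nu> := b])"
proof -
  let ?K = "{k. k < length as \<and> above (as ! k) b}"
  define \<nu> where "\<nu> = Max ?K"
  have "\<nu> \<in> ?K" unfolding \<nu>_def using assms by (intro Max_in) auto
  then have \<nu>: "\<nu> < length as" "above (as ! \<nu>) b" by auto
  have max: "k \<le> \<nu>" if "k < length as" "above (as ! k) b" for k
    unfolding \<nu>_def using that by (intro Max_ge) auto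
  have le: "as ! j \<le> as ! k" if "j \<le> k" "k < length as" for j k
    using assms(1) that by (simp add: sorted_nth_mono)
  have pred: "is_pred (set as) b (as ! \<nu>)"
    using \<nu> max le by (auto simp: is_pred_def in_set_conv_nth)
  have "replace (as ! \<nu>) b as = as[\<nu> := b]"
  proof (rule replace_nth)
    show "as ! j \<le> b" if "j < \<nu>" for j
      using le[of j \<nu>] that \<nu> by (auto simp: above_def)
    show "b \<le> as ! j" if "\<nu> < j" "j < length as" for j
      using max[of j] that by (force simp: above_def)
  qed (use assms \<nu> in auto)
  then show ?thesis using exchange_eq[OF pred] by (simp add: \<nu>_def Let_def)
qed

lemma exchange_inv_row:
  assumes "sorted as" "as \<noteq> []" "\<not> above b (last as)"
  shows "exchange_inv (b, as) = (tl as @ [b], as ! 0)"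
proof -
  have first: "as ! 0 \<le> x" "x \<le> last as" if "x \<in> set as" for x
    using assms(1,2) that by (auto simp: in_set_conv_nth last_conv_nth sorted_nth_mono)
  have succ: "is_succ (set as) b (as ! 0)"
    using first assms(2,3) by (force simp: is_succ_def above_def)
  have "x \<le> b" if "x \<in> set as" for x
    using first(2)[OF that] assms(3) by (simp add: above_def)
  then have "tl as @ [b] = replace (as ! 0) b as"
    using assms(1,2) by (intro replace_eq_of_content; cases as) (auto simp: sorted_append)
  then show ?thesis using exchange_inv_eq[OF succ] by simp
qed

lemma exchange_inv_col:
  assumes "sorted as" "as \<noteq> []" "above b (last as)"
  shows "let \<nu> = Min {k. k < length as \<and> above b (as ! k)} in exchange_inv (b, as) = (as[\<nu> := b], as ! \<nu>)"
proof -
  let ?K = "{k. k < length as \<and> above b (as ! k)}"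
  define \<nu> where "\<nu> = Min ?K"
  have "length as - 1 \<in> ?K" using assms by (auto simp: last_conv_nth)
  then have "\<nu> \<in> ?K" unfolding \<nu>_def by (intro Min_in) auto
  then have \<nu>: "\<nu> < length as" "above b (as ! \<nu>)" by auto
  have min: "\<nu> \<le> k" if "k < length as" "above b (as ! k)" for k
    unfolding \<nu>_def using that by (intro Min_le) auto
  have le: "as ! j \<le> as ! k" if "j \<le> k" "k < length as" for j k
    using assms(1) that by (simp add: sorted_nth_mono)
  have succ: "is_succ (set as) b (as ! \<nu>)"
    using \<nu> min le by (auto simp: is_succ_def in_set_conv_nth)
  have "replace (as ! \<nu>) b as = as[\<nu> := b]"
  proof (rule replace_nth)
    show "as ! j \<le> b" if "j < \<nu>" for j
      using min[of j] that \<nu> by (force simp: above_def)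
    show "b \<le> as ! j" if "\<nu> < j" "j < length as" for j
      using le[of \<nu> j] that \<nu> by (auto simp: above_def)
  qed (use assms \<nu> in auto)
  then show ?thesis using exchange_inv_eq[OF succ] by (simp add: \<nu>_def Let_def)
qed

lemma replace_replace:
  assumes "sorted as" "x \<in> set as"
  shows "replace y x (replace x y as) = as"
  by (rule replace_eq_of_content[symmetric]) (use assms in \<open>auto simp: sorted_replace set_replace\<close>)

lemma exchange_iso:
  assumes m: "m \<ge> 1" and n: "n \<ge> 1" and r: "r \<ge> 1"
  defines "R \<equiv> row_crystal m n r" and "L \<equiv> letter_crystal m n"
  shows "crystal_iso (indices m n) (tensor R L) (tensor L R) exchange"
    and "crystal_iso (indices m n) (tensor L R) (tensor R L) exchange_inv"
    and "x \<in> elems (tensor R L) \<Longrightarrow> exchange_inv (exchange x) = x"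
    and "y \<in> elems (tensor L R) \<Longrightarrow> exchange (exchange_inv y) = y"
proof -
  \<comment> \<open>the facts about carriers hold for every index, and \<open>0\<close> is always one\<close>
  have "0 \<in> indices m n" using m n by (simp add: indices_def)
  then interpret zero: row_crystal_index m n r 0 by unfold_locales (use m n r in auto)
  have elems: "elems (tensor R L) = elems R \<times> elems L" "elems (tensor L R) = elems L \<times> elems R"
    by (simp_all add: tensor_def)
  have rowD: "sorted as" "set as \<noteq> {}" "set as \<subseteq> elems L" "repeated as \<subseteq> {..<0}" if "as \<in> elems R" for as
    using that r zero.repeated_neg
    by (auto simp: R_def L_def row_crystal_elems semistandard_row_iff letter_crystal_def)
  have fwd: "exchange x \<in> elems (tensor L R) \<and> exchange_inv (exchange x) = x \<and>
      wt (tensor L R) (exchange x) = wt (tensor R L) x"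
    if "x \<in> elems (tensor R L)" for x
  proof -
    obtain as b where x: "x = (as, b)" and as: "as \<in> elems R" and b: "b \<in> elems L"
      using \<open>x \<in> elems (tensor R L)\<close> by (auto simp: elems)
    obtain a where pred: "is_pred (set as) b a"
      using is_pred_exists rowD[OF as] by blast
    then have a: "a \<in> set as" by (simp add: is_pred_def)
    note ex = exchange_eq[OF pred]
    have as': "replace a b as \<in> elems R"
      using zero.exchange_elem as b pred by (simp add: R_def L_def)
    have "is_succ (set (replace a b as)) a b"
      unfolding set_replace_repeated[OF a] using pred rowD(4)[OF as] by (rule is_succ_replaced)
    then have "exchange_inv (exchange x) = x"
      using replace_replace[OF rowD(1)[OF as] a] by (simp add: x ex exchange_inv_eq)
    moreover have "wt (tensor L R) (exchange x) c = wt (tensor R L) x c" for c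
    proof -
      have "wt (tensor L R) (exchange x) c = int (count (add_mset a (mset (replace a b as))) c)"
        using as' unfolding x ex
        by (simp add: tensor_def R_def L_def row_crystal_elems row_crystal_wt letter_crystal_def)
      also have "add_mset a (mset (replace a b as)) = add_mset b (mset as)"
        using a by (simp add: add_mset_commute)
      also have "int (count (add_mset b (mset as)) c) = wt (tensor R L) x c"
        using as unfolding x
        by (simp add: tensor_def R_def L_def row_crystal_elems row_crystal_wt letter_crystal_def)
      finally show ?thesis .
    qed
    ultimately show ?thesis using ex a rowD(3)[OF as] as' by (auto simp: x elems)
  qed
  have bwd: "exchange_inv y \<in> elems (tensor R L) \<and> exchange (exchange_inv y) = y"
    if "y \<in> elems (tensor L R)" for y
  proof -
    obtain as a where y: "y = (a, as)" and as: "as \<in> elems R" and a: "a \<in> elems L"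
      using \<open>y \<in> elems (tensor L R)\<close> by (auto simp: elems)
    obtain b where succ: "is_succ (set as) a b"
      using is_succ_exists rowD[OF as] by blast
    then have b: "b \<in> set as" by (simp add: is_succ_def)
    note ex = exchange_inv_eq[OF succ]
    have as': "replace b a as \<in> elems R"
      using zero.exchange_inv_elem as a succ by (simp add: R_def L_def)
    have "is_pred (set (replace b a as)) b a"
      unfolding set_replace_repeated[OF b] using succ rowD(4)[OF as] by (rule is_pred_replaced)
    then have "exchange (exchange_inv y) = y"
      using replace_replace[OF rowD(1)[OF as] b] by (simp add: y ex exchange_eq)
    then show ?thesis using ex b rowD(3)[OF as] as' by (auto simp: y elems)
  qed
  show inv: "x \<in> elems (tensor R L) \<Longrightarrow> exchange_inv (exchange x) = x" for x
    using fwd by blast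
  show "y \<in> elems (tensor L R) \<Longrightarrow> exchange (exchange_inv y) = y"
    using bwd by blast
  have "bij_betw exchange (elems (tensor R L)) (elems (tensor L R))"
    by (rule bij_betw_byWitness[where f' = exchange_inv]) (use fwd bwd in auto)
  moreover have "eop (tensor L R) i (exchange x) = map_option exchange (eop (tensor R L) i x)"
      "fop (tensor L R) i (exchange x) = map_option exchange (fop (tensor R L) i x)"
    if "i \<in> indices m n" "x \<in> elems (tensor R L)" for i x
  proof -
    interpret row_crystal_index m n r i by unfold_locales (use that m n r in auto)
    obtain as b where "x = (as, b)" "as \<in> elems R" "b \<in> elems L"
      using \<open>x \<in> elems (tensor R L)\<close> by (auto simp: elems)
    then show "eop (tensor L R) i (exchange x) = map_option exchange (eop (tensor R L) i x)"
      "fop (tensor L R) i (exchange x) = map_option exchange (fop (tensor R L) i x)"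
      using exchange_commutes_with_operators by (simp_all add: R_def L_def)
  qed
  ultimately show iso: "crystal_iso (indices m n) (tensor R L) (tensor L R) exchange"
    unfolding crystal_iso_def using fwd by blast
  show "crystal_iso (indices m n) (tensor L R) (tensor R L) exchange_inv"
  proof (rule crystal_iso_inverse[OF iso])
    fix i x y
    assume *: "i \<in> indices m n" "x \<in> elems (tensor R L)"
      "eop (tensor R L) i x = Some y \<or> fop (tensor R L) i x = Some y"
    interpret row_crystal_index m n r i by unfold_locales (use m n r * in auto)
    show "y \<in> elems (tensor R L)"
      using row_letter_closed * by (simp add: R_def L_def)
  qed (rule inv)
qed

theorem theorem4p12:
  fixes m n :: int and r :: nat
  assumes "m \<ge> 1" and "n \<ge> 1" and "r \<ge> 1"
  shows "\<exists>(\<Phi> :: int list \<times> int \<Rightarrow> int \<times> int list) (\<Psi> :: int \<times> int list \<Rightarrow> int list \<times> int).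
    crystal_iso (indices m n)
      (tensor (row_crystal m n r) (letter_crystal m n))
      (tensor (letter_crystal m n) (row_crystal m n r)) \<Phi> \<and>
    crystal_iso (indices m n)
      (tensor (letter_crystal m n) (row_crystal m n r))
      (tensor (row_crystal m n r) (letter_crystal m n)) \<Psi> \<and>
    (\<forall>x \<in> elems (tensor (row_crystal m n r) (letter_crystal m n)). \<Psi> (\<Phi> x) = x) \<and>
    (\<forall>y \<in> elems (tensor (letter_crystal m n) (row_crystal m n r)). \<Phi> (\<Psi> y) = y) \<and>
    (\<forall>as \<in> elems (row_crystal m n r). \<forall>b \<in> elems (letter_crystal m n).
      (semistandard_row m n [b, as ! 0] \<longrightarrow>
        \<Phi> (as, b) = (last as, b # butlast as)) \<and>
      (semistandard_col m n [as ! 0, b] \<longrightarrow>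
        (let \<nu> = Max {k. k < r \<and> semistandard_col m n [as ! k, b]}
         in \<Phi> (as, b) = (as ! \<nu>, as[\<nu> := b]))) \<and>
      (semistandard_row m n [as ! (r - 1), b] \<longrightarrow>
        \<Psi> (b, as) = (tl as @ [b], as ! 0)) \<and>
      (semistandard_col m n [b, as ! (r - 1)] \<longrightarrow>
        (let \<nu> = Min {k. k < r \<and> semistandard_col m n [b, as ! k]}
         in \<Psi> (b, as) = (as[\<nu> := b], as ! \<nu>))))"
proof (intro exI[of _ exchange] exI[of _ exchange_inv] conjI ballI)
  fix as b
  assume as: "as \<in> elems (row_crystal m n r)" and b: "b \<in> elems (letter_crystal m n)"
  have len: "length as = r" "as \<noteq> []" "sorted as" and lets: "set as \<subseteq> letters m n" "b \<in> letters m n"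
    using as b assms(3) by (auto simp: row_crystal_elems semistandard_row_iff letter_crystal_def)
  have nth: "as ! k \<in> letters m n" if "k < r" for k
    using lets(1) len(1) that nth_mem by blast
  have r: "0 < r" "r - 1 < r" using assms(3) by auto
  have last: "as ! (r - 1) = last as" using len by (simp add: last_conv_nth)
  have cols: "{k. k < r \<and> semistandard_col m n [as ! k, b]} = {k. k < length as \<and> above (as ! k) b}"
    "{k. k < r \<and> semistandard_col m n [b, as ! k]} = {k. k < length as \<and> above b (as ! k)}"
    using nth lets(2) len(1) by (auto simp: semistandard_pair)
  note pair = semistandard_pair[OF nth[OF r(1)] lets(2)] semistandard_pair[OF lets(2) nth[OF r(2)]]
  show "semistandard_row m n [b, as ! 0] \<longrightarrow> exchange (as, b) = (last as, b # butlast as)"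
    using exchange_row len pair by simp
  show "semistandard_col m n [as ! 0, b] \<longrightarrow>
      (let \<nu> = Max {k. k < r \<and> semistandard_col m n [as ! k, b]}
       in exchange (as, b) = (as ! \<nu>, as[\<nu> := b]))"
    unfolding cols pair using exchange_col len by blast
  show "semistandard_row m n [as ! (r - 1), b] \<longrightarrow> exchange_inv (b, as) = (tl as @ [b], as ! 0)"
    using exchange_inv_row len pair last by simp
  show "semistandard_col m n [b, as ! (r - 1)] \<longrightarrow>
      (let \<nu> = Min {k. k < r \<and> semistandard_col m n [b, as ! k]}
       in exchange_inv (b, as) = (as[\<nu> := b], as ! \<nu>))"
    unfolding cols pair[unfolded last] last using exchange_inv_col len by blast
qed (use exchange_iso[OF assms] in auto)

end
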